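(* Let $E=\left\{\begin{pmatrix}a&b\\0&1\end{pmatrix}: a>0,\ b\in\mathbb{R}\right\}$ (with its usual Lie group topology). Then $CD_{reg}(E)$ is not inverse-closed in $B(L^2(E))$; that is, some operator in $CD_{reg}(E)+\mathbb{C}\,\mathrm{id}$ is invertible in $B(L^2(E))$ but not invertible in $CD_{reg}(E)+\mathbb{C}\,\mathrm{id}$.
   Context: For a locally compact group $G$ fix a left Haar measure $dx$, with modular function $\Delta$ (so that $\int_G f(x^{-1})\Delta(x^{-1})\,dx=\int_G f(x)\,dx$). For $y\in G$ let $(T_yn)(z)=n(y^{-1}z)$. $Ruc(G)$ is the space of bounded right uniformly continuous functions, i.e. the subspace of $L^\infty(G)$ of those elements on which left translation acts norm continuously ($y\mapsto T_yn$ is continuous for $\|\cdot\|_\infty$); it consists of continuous functions and is a $C^*$-algebra. The twisted $L^1$-algebra $\mathcal{L}=L^1(G,Ruc(G),T)$ is the Banach space of Bochner integrable functions $G\to Ruc(G)$ with norm $\int_G\|f(x)\|_\infty dx$, with product $(h\star f)(x)=\int_G T_y(h(xy))\,f(y^{-1})\,dy$ and involution $h^*(x)=\Delta(x^{-1})\,\overline{T_{x^{-1}}(h(x^{-1}))}$. The map $R:\mathcal{L}\to B(L^2(G))$ is given by $(R(f)h)(x)=\int_G f(y)(y^{-1}x)\,h(y^{-1}x)\,dy$. The algebra of regular convolution dominated operators is $CD_{reg}(G)=R(\mathcal{L})\subset B(L^2(G))$. *)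

theory Defs
  imports "HOL-Analysis.Analysis"
begin

section \<open>Locally compact groups and Haar measure\<close>

class locally_compact_group = t2_space + monoid_mult + inverse +
  assumes left_inverse_group: "inverse x * x = 1"
    and divide_group: "x / y = x * inverse y"
    and tendsto_mult_Pair_group: "filterlim (\<lambda>p. fst p * snd p) (nhds (x * y)) (nhds x \<times>\<^sub>F nhds y)"
    and tendsto_inverse_nhds_group: "filterlim inverse (nhds (inverse x)) (nhds x)"
    and locally_compact_group: "\<exists>U K. open U \<and> compact K \<and> x \<in> U \<and> U \<subseteq> K"

lemma continuous_on_UNIV_iff_nhds:
  "continuous_on UNIV f \<longleftrightarrow> (\<forall>x. filterlim f (nhds (f x)) (nhds x))"
  by (simp add: continuous_on_def tendsto_at_iff_tendsto_nhds)

lemma continuous_mult_group: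
  "continuous_on UNIV (\<lambda>p. fst p * snd p :: 'a::locally_compact_group)"
  unfolding continuous_on_UNIV_iff_nhds by (auto simp: nhds_prod intro: tendsto_mult_Pair_group)

text \<open>The regularity conditions are the usual ones for a Radon measure on a locally compact
  Hausdorff space.\<close>

definition left_haar_measure :: "'a::locally_compact_group measure \<Rightarrow> bool" where
  "left_haar_measure \<mu> \<longleftrightarrow>
     sets \<mu> = sets borel \<and>
     (\<forall>K. compact K \<longrightarrow> emeasure \<mu> K < \<infinity>) \<and>
     (\<forall>A\<in>sets borel. emeasure \<mu> A = (INF U\<in>{U. open U \<and> A \<subseteq> U}. emeasure \<mu> U)) \<and>
     (\<forall>U. open U \<longrightarrow> emeasure \<mu> U = (SUP K\<in>{K. compact K \<and> K \<subseteq> U}. emeasure \<mu> K)) \<and>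
     emeasure \<mu> UNIV \<noteq> 0 \<and>
     (\<forall>x. \<forall>A\<in>sets borel. emeasure \<mu> ((\<lambda>y. x * y) ` A) = emeasure \<mu> A)"


section \<open>Right uniformly continuous functions and the twisted $L^1$-space\<close>

definition left_translate ::
    "'a::locally_compact_group \<Rightarrow> ('a \<Rightarrow>\<^sub>C complex) \<Rightarrow> ('a \<Rightarrow>\<^sub>C complex)" where
  "left_translate y n = Bcontfun (\<lambda>z. apply_bcontfun n (inverse y * z))"

lemma apply_left_translate [simp]:
  fixes n :: "'a::locally_compact_group \<Rightarrow>\<^sub>C complex"
  shows "apply_bcontfun (left_translate y n) z = apply_bcontfun n (inverse y * z)"
proof -
  have "continuous_on UNIV (\<lambda>z. fst (inverse y, z) * snd (inverse y, z))"
    by (rule continuous_on_compose2[OF continuous_mult_group]) (auto intro!: continuous_intros)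
  then have "continuous_on UNIV (\<lambda>z. apply_bcontfun n (inverse y * z))"
    by (auto intro: continuous_on_compose2[OF continuous_on_apply_bcontfun[of UNIV]])
  moreover have "bounded (range (\<lambda>z. apply_bcontfun n (inverse y * z)))"
    by (rule bounded_subset[OF bounded_apply_bcontfun[of n]]) auto
  ultimately show ?thesis
    by (simp add: left_translate_def Bcontfun_inverse bcontfun_def)
qed

text \<open>The elements of $L^\infty(G)$ on which left translation acts norm continuously have a unique
  continuous representative, whose sup norm is its essential sup norm.  We work with these
  representatives, which is also what the pointwise evaluation in \<open>twisted_rep\<close> below requires.\<close>

definition Ruc :: "('a::locally_compact_group \<Rightarrow>\<^sub>C complex) set" where
  "Ruc = {n. continuous_on UNIV (\<lambda>y. left_translate y n)}"

text \<open>Bochner integrability is spelled out because \<open>integrable\<close> is only available for second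
  countable codomains, whereas \<open>Ruc\<close> is in general not separable.  Elements of the
  twisted $L^1$-space are represented by functions that are everywhere (not only almost everywhere)
  limits of simple functions; every almost-everywhere class contains such a representative.\<close>

definition twisted_L1 :: "'a::locally_compact_group measure \<Rightarrow> ('a \<Rightarrow> ('a \<Rightarrow>\<^sub>C complex)) set" where
  "twisted_L1 \<mu> = {f.
     (\<forall>x. f x \<in> Ruc) \<and>
     (\<exists>s. (\<forall>i::nat. simple_function \<mu> (s i) \<and> (\<forall>x. s i x \<in> Ruc)) \<and>
          (\<forall>x. (\<lambda>i. s i x) \<longlonglongrightarrow> f x)) \<and>
     (\<integral>\<^sup>+ x. ennreal (norm (f x)) \<partial>\<mu>) < \<infinity>}"


section \<open>Operators on $L^2$\<close>

text \<open>Elements of $L^2$ are represented by square integrable functions, identified when they agree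
  almost everywhere; operators are identified accordingly by \<open>op_eq\<close>.  Members of \<open>B_L2\<close>
  automatically respect equality almost everywhere, by linearity and boundedness.\<close>

definition L2 :: "'a measure \<Rightarrow> ('a \<Rightarrow> complex) set" where
  "L2 \<mu> = {h \<in> borel_measurable \<mu>. integrable \<mu> (\<lambda>x. (norm (h x))\<^sup>2)}"

definition L2_norm :: "'a measure \<Rightarrow> ('a \<Rightarrow> complex) \<Rightarrow> real" where
  "L2_norm \<mu> h = sqrt (\<integral>x. (norm (h x))\<^sup>2 \<partial>\<mu>)"

type_synonym 'a operator = "('a \<Rightarrow> complex) \<Rightarrow> ('a \<Rightarrow> complex)"

definition B_L2 :: "'a measure \<Rightarrow> 'a operator set" where
  "B_L2 \<mu> = {T.
     (\<forall>h\<in>L2 \<mu>. T h \<in> L2 \<mu>) \<and>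
     (\<forall>h\<in>L2 \<mu>. \<forall>k\<in>L2 \<mu>. AE x in \<mu>. T (\<lambda>z. h z + k z) x = T h x + T k x) \<and>
     (\<forall>h\<in>L2 \<mu>. \<forall>c. AE x in \<mu>. T (\<lambda>z. c * h z) x = c * T h x) \<and>
     (\<exists>C. \<forall>h\<in>L2 \<mu>. L2_norm \<mu> (T h) \<le> C * L2_norm \<mu> h)}"

definition op_eq :: "'a measure \<Rightarrow> 'a operator \<Rightarrow> 'a operator \<Rightarrow> bool" where
  "op_eq \<mu> S T \<longleftrightarrow> (\<forall>h\<in>L2 \<mu>. AE x in \<mu>. S h x = T h x)"

definition adjoin_id :: "'a measure \<Rightarrow> 'a operator set \<Rightarrow> 'a operator set" where
  "adjoin_id \<mu> \<A> = {T \<in> B_L2 \<mu>. \<exists>A\<in>\<A>. \<exists>c. op_eq \<mu> T (\<lambda>h x. A h x + c * h x)}"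

definition invertible_in :: "'a measure \<Rightarrow> 'a operator set \<Rightarrow> 'a operator \<Rightarrow> bool" where
  "invertible_in \<mu> \<A> T \<longleftrightarrow> (\<exists>S\<in>\<A>. op_eq \<mu> (S \<circ> T) id \<and> op_eq \<mu> (T \<circ> S) id)"

definition inverse_closed :: "'a measure \<Rightarrow> 'a operator set \<Rightarrow> bool" where
  "inverse_closed \<mu> \<A> \<longleftrightarrow>
     (\<forall>T \<in> adjoin_id \<mu> \<A>. invertible_in \<mu> (B_L2 \<mu>) T \<longrightarrow> invertible_in \<mu> (adjoin_id \<mu> \<A>) T)"


section \<open>Regular convolution dominated operators\<close>

definition twisted_rep ::
    "'a::locally_compact_group measure \<Rightarrow> ('a \<Rightarrow> ('a \<Rightarrow>\<^sub>C complex)) \<Rightarrow> 'a operator" where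
  "twisted_rep \<mu> f h x = (\<integral>y. apply_bcontfun (f y) (inverse y * x) * h (inverse y * x) \<partial>\<mu>)"

definition CD_reg :: "'a::locally_compact_group measure \<Rightarrow> 'a operator set" where
  "CD_reg \<mu> = {T \<in> B_L2 \<mu>. \<exists>f\<in>twisted_L1 \<mu>. op_eq \<mu> T (twisted_rep \<mu> f)}"


section \<open>The affine group of the real line\<close>

definition aff_matrix :: "real \<Rightarrow> real \<Rightarrow> real^2^2" where
  "aff_matrix a b = vector [vector [a, b], vector [0, 1]]"

lemma aff_matrix_nth [simp]:
  "aff_matrix a b $ 1 $ 1 = a" "aff_matrix a b $ 1 $ 2 = b"
  "aff_matrix a b $ 2 $ 1 = 0" "aff_matrix a b $ 2 $ 2 = 1"
  by (simp_all add: aff_matrix_def vector_2)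

lemma aff_matrix_mult:
  "aff_matrix a b ** aff_matrix c d = aff_matrix (a * c) (a * d + b)"
  by (simp add: vec_eq_iff forall_2 matrix_matrix_mult_def sum_2)

lemma aff_matrix_one: "mat 1 = aff_matrix 1 0"
  by (simp add: vec_eq_iff forall_2 mat_def)

lemma aff_matrix_inv:
  assumes "a > 0"
  shows "matrix_inv (aff_matrix a b) = aff_matrix (1 / a) (- b / a)"
proof -
  have 1: "aff_matrix a b ** aff_matrix (1 / a) (- b / a) = mat 1"
    and 2: "aff_matrix (1 / a) (- b / a) ** aff_matrix a b = mat 1"
    using assms by (simp_all add: aff_matrix_mult aff_matrix_one)
  then have "aff_matrix a b ** matrix_inv (aff_matrix a b) = mat 1 \<and>
      matrix_inv (aff_matrix a b) ** aff_matrix a b = mat 1"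
    unfolding matrix_inv_def by (rule someI[of _ "aff_matrix (1 / a) (- b / a)", OF conjI])
  then show ?thesis
    using 1 by (metis matrix_mul_assoc matrix_mul_lid matrix_mul_rid)
qed

typedef aff = "{A. \<exists>a b. a > 0 \<and> A = aff_matrix a b}"
  by (rule exI[of _ "aff_matrix 1 0"], rule CollectI, rule exI[of _ 1], rule exI[of _ 0]) simp

lemma Rep_aff_cases:
  obtains a b where "a > 0" "Rep_aff x = aff_matrix a b"
  using Rep_aff[of x] by auto

instantiation aff :: "{monoid_mult, inverse}"
begin

definition one_aff :: aff where "1 = Abs_aff (mat 1)"
definition times_aff :: "aff \<Rightarrow> aff \<Rightarrow> aff" where "x * y = Abs_aff (Rep_aff x ** Rep_aff y)"
definition inverse_aff :: "aff \<Rightarrow> aff" where "inverse x = Abs_aff (matrix_inv (Rep_aff x))"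
definition divide_aff :: "aff \<Rightarrow> aff \<Rightarrow> aff" where "x div y = x * inverse y" for x y :: aff

lemma Rep_aff_one: "Rep_aff 1 = mat 1"
  unfolding one_aff_def aff_matrix_one
  by (rule Abs_aff_inverse, rule CollectI, rule exI[of _ 1], rule exI[of _ 0]) simp

lemma Rep_aff_times: "Rep_aff (x * y) = Rep_aff x ** Rep_aff y"
  unfolding times_aff_def
proof (rule Abs_aff_inverse)
  obtain a b where "a > 0" "Rep_aff x = aff_matrix a b" by (rule Rep_aff_cases)
  moreover obtain c d where "c > 0" "Rep_aff y = aff_matrix c d" by (rule Rep_aff_cases)
  ultimately show "Rep_aff x ** Rep_aff y \<in> {A. \<exists>a b. a > 0 \<and> A = aff_matrix a b}"
    using mult_pos_pos[of a c] by (auto simp: aff_matrix_mult intro: exI[of _ "a * c"])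
qed

lemma Rep_aff_inverse': "Rep_aff (inverse x) = matrix_inv (Rep_aff x)"
  unfolding inverse_aff_def
proof (rule Abs_aff_inverse)
  obtain a b where "a > 0" "Rep_aff x = aff_matrix a b" by (rule Rep_aff_cases)
  then have "1 / a > 0" "matrix_inv (Rep_aff x) = aff_matrix (1 / a) (- b / a)"
    by (auto simp: aff_matrix_inv)
  then show "matrix_inv (Rep_aff x) \<in> {A. \<exists>a b. a > 0 \<and> A = aff_matrix a b}" by blast
qed

instance
  by standard (auto simp: Rep_aff_inject[symmetric] Rep_aff_one Rep_aff_times matrix_mul_assoc)

end

text \<open>The topology is the one induced from the space of real matrices.\<close>

instantiation aff :: t2_space
begin

definition open_aff :: "aff set \<Rightarrow> bool" where
  "open U \<longleftrightarrow> (\<exists>V. open V \<and> U = Rep_aff -` V)"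

instance
proof
  show "open (UNIV :: aff set)"
    unfolding open_aff_def by (intro exI[of _ UNIV]) auto
next
  fix S T :: "aff set"
  assume "open S" "open T"
  then obtain V W where "open V" "S = Rep_aff -` V" "open W" "T = Rep_aff -` W"
    unfolding open_aff_def by blast
  then show "open (S \<inter> T)"
    unfolding open_aff_def by (intro exI[of _ "V \<inter> W"]) auto
next
  fix K :: "aff set set"
  assume "\<forall>S\<in>K. open S"
  then obtain V where "\<forall>S\<in>K. open (V S) \<and> S = Rep_aff -` V S"
    unfolding open_aff_def by metis
  then show "open (\<Union>K)"
    unfolding open_aff_def by (intro exI[of _ "\<Union>S\<in>K. V S"]) blast
next
  fix x y :: aff
  assume "x \<noteq> y"
  then have "Rep_aff x \<noteq> Rep_aff y"
    by (simp add: Rep_aff_inject)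
  then obtain V W where "open V" "open W" "Rep_aff x \<in> V" "Rep_aff y \<in> W" "V \<inter> W = {}"
    by (meson hausdorff)
  then show "\<exists>U V. open U \<and> open V \<and> x \<in> U \<and> y \<in> V \<and> U \<inter> V = {}"
    unfolding open_aff_def
    by (intro exI[of _ "Rep_aff -` V"] exI[of _ "Rep_aff -` W"]) auto
qed

end

lemma continuous_on_Rep_aff: "continuous_on S Rep_aff"
  by (rule continuous_on_subset[of UNIV])
    (auto simp: continuous_on_open_vimage[OF open_UNIV] open_aff_def)

lemma continuous_on_aff_iff:
  fixes f :: "'b::topological_space \<Rightarrow> aff"
  shows "continuous_on S f \<longleftrightarrow> continuous_on S (\<lambda>x. Rep_aff (f x))"
proof
  assume "continuous_on S f"
  then show "continuous_on S (\<lambda>x. Rep_aff (f x))"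
    by (rule continuous_on_compose2[OF continuous_on_Rep_aff]) auto
next
  assume *: "continuous_on S (\<lambda>x. Rep_aff (f x))"
  show "continuous_on S f"
    unfolding continuous_on_open_invariant
  proof (intro allI impI)
    fix B :: "aff set"
    assume "open B"
    then obtain V where "open V" "B = Rep_aff -` V"
      unfolding open_aff_def by blast
    with * show "\<exists>A. open A \<and> A \<inter> S = f -` B \<inter> S"
      unfolding continuous_on_open_invariant by (auto simp: vimage_def)
  qed
qed

lemma continuous_on_aff_matrix:
  assumes "continuous_on S f" "continuous_on S g"
  shows "continuous_on S (\<lambda>x. aff_matrix (f x) (g x))"
proof -
  have "aff_matrix a b = (\<chi> i j. if i = 1 then (if j = 1 then a else b) else (if j = 1 then 0 else 1))"
    for a b
    by (simp add: vec_eq_iff forall_2)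
  moreover have "continuous_on S (\<lambda>x. (\<chi> (i::2) (j::2).
      if i = 1 then (if j = 1 then f x else g x) else (if j = 1 then 0 else 1)))"
  proof (intro continuous_on_vec_lambda)
    fix i j :: 2
    show "continuous_on S (\<lambda>x. if i = 1 then (if j = 1 then f x else g x)
        else (if j = 1 then 0 else 1))"
      using assms by (cases "i = 1"; cases "j = 1") simp_all
  qed
  ultimately show ?thesis by simp
qed

instance aff :: locally_compact_group
proof
  fix x y :: aff
  show "inverse x * x = 1"
  proof -
    obtain a b where "a > 0" "Rep_aff x = aff_matrix a b" by (rule Rep_aff_cases)
    then show ?thesis
      by (simp add: Rep_aff_inject[symmetric] Rep_aff_one Rep_aff_times Rep_aff_inverse'
          aff_matrix_inv aff_matrix_mult aff_matrix_one)
  qed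
  show "x / y = x * inverse y"
    by (rule divide_aff_def)
  have "continuous_on UNIV (\<lambda>p. fst p * snd p :: aff)"
    unfolding continuous_on_aff_iff Rep_aff_times matrix_matrix_mult_def
    by (intro continuous_on_vec_lambda continuous_intros
        continuous_on_compose2[OF continuous_on_Rep_aff[of UNIV]]) auto
  then show "filterlim (\<lambda>p. fst p * snd p) (nhds (x * y)) (nhds x \<times>\<^sub>F nhds y)"
    unfolding continuous_on_UNIV_iff_nhds by (auto simp flip: nhds_prod dest: spec[of _ "(x, y)"])
  have "continuous_on UNIV (inverse :: aff \<Rightarrow> aff)"
  proof -
    have eq: "Rep_aff (inverse z) =
        aff_matrix (1 / Rep_aff z $ 1 $ 1) (- Rep_aff z $ 1 $ 2 / Rep_aff z $ 1 $ 1)" for z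
      using aff_matrix_inv by (cases rule: Rep_aff_cases[of z]) (simp add: Rep_aff_inverse')
    have nz: "Rep_aff z $ 1 $ 1 \<noteq> 0" for z
      by (cases rule: Rep_aff_cases[of z]) simp
    show ?thesis
      unfolding continuous_on_aff_iff eq
      by (intro continuous_on_aff_matrix continuous_intros continuous_on_Rep_aff) (auto simp: nz)
  qed
  then show "filterlim inverse (nhds (inverse x)) (nhds x)"
    unfolding continuous_on_UNIV_iff_nhds by blast
  show "\<exists>U K. open U \<and> compact K \<and> x \<in> U \<and> U \<subseteq> K"
  proof -
    obtain a b where ab: "a > 0" "Rep_aff x = aff_matrix a b" by (rule Rep_aff_cases)
    define m where "m = (\<lambda>p. Abs_aff (aff_matrix (fst p) (snd p)))"
    define U where "U = Rep_aff -` {A. a / 2 < A $ 1 $ 1 \<and> A $ 1 $ 1 < 2 * a \<and>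
                                      b - 1 < A $ 1 $ 2 \<and> A $ 1 $ 2 < b + 1}"
    define K where "K = m ` ({a / 2..2 * a} \<times> {b - 1..b + 1})"
    have Rep_m: "Rep_aff (m p) = aff_matrix (fst p) (snd p)" if "fst p > 0" for p
      unfolding m_def using that by (intro Abs_aff_inverse) blast
    have "open {A :: real^2^2. a / 2 < A $ 1 $ 1 \<and> A $ 1 $ 1 < 2 * a \<and>
                    b - 1 < A $ 1 $ 2 \<and> A $ 1 $ 2 < b + 1}"
      by (intro open_Collect_conj open_Collect_less continuous_intros)
    then have "open U"
      unfolding U_def open_aff_def by blast
    moreover have "compact K"
      unfolding K_def
    proof (rule compact_continuous_image)
      have "continuous_on ({a / 2..2 * a} \<times> {b - 1..b + 1}) (\<lambda>p. aff_matrix (fst p) (snd p))"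
        by (intro continuous_on_aff_matrix continuous_intros)
      then show "continuous_on ({a / 2..2 * a} \<times> {b - 1..b + 1}) m"
        unfolding continuous_on_aff_iff
        by (rule continuous_on_eq) (use ab in \<open>auto simp: Rep_m\<close>)
    qed (intro compact_Times compact_Icc)
    moreover have "x \<in> U"
      using ab by (simp add: U_def)
    moreover have "U \<subseteq> K"
    proof
      fix z
      assume z: "z \<in> U"
      obtain c d where cd: "c > 0" "Rep_aff z = aff_matrix c d" by (rule Rep_aff_cases)
      then have "z = m (c, d)"
        by (simp add: Rep_aff_inject[symmetric] Rep_m)
      with z cd show "z \<in> K"
        unfolding K_def U_def by auto
    qed
    ultimately show ?thesis by blast
  qed
qed

end

theory Submission
  imports Defs
begin

text \<open>Every element of \<open>CD_reg \<mu>\<close> is dominated by left convolution with an integrable function,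
  so it maps \<open>L\<^sup>1 \<inter> L\<^sup>2\<close> into \<open>L\<^sup>1\<close>, and so does every element of \<open>adjoin_id \<mu> (CD_reg \<mu>)\<close>
  (\<open>adjoin_id_CD_reg_L1\<close>).  It therefore suffices to find an \<open>S\<close> in \<open>CD_reg \<mu>\<close> of norm less than
  one on \<open>L\<^sup>2\<close> for which the \<open>L\<^sup>2\<close>-inverse of \<open>id - S\<close> does not map \<open>L\<^sup>1 \<inter> L\<^sup>2\<close> into \<open>L\<^sup>1\<close>.

  Take \<open>S h = \<phi> \<star> (n h)\<close>, where \<open>\<phi>\<close> is a normalised indicator function on the group and \<open>n\<close>
  depends only on the translation part \<open>b\<close> of \<open>(a, b)\<close>, equals \<open>1\<close> for \<open>\<bar>b\<bar> \<le> 3\<close> and vanishes for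
  \<open>\<bar>b\<bar> \<ge> 4\<close>.  The support of \<open>\<phi>\<close> consists of the elements that contract by a factor between \<open>1 / 32\<close>
  and \<open>1 / 16\<close> and then translate by an amount in \<open>[-2, 2)\<close>.  Such an element maps the band
  \<open>\<bar>b\<bar> \<le> 3\<close> into itself, so \<open>S\<close> preserves the integral of a nonnegative function supported on the band,
  and nothing leaves the band (\<open>L1_growth\<close>).  The solution of \<open>G = h + S G\<close>, for \<open>h\<close> the indicator
  function of a piece of the band, then satisfies \<open>\<integral> G \<ge> \<integral> h + \<integral> G\<close> over the band, so it is not
  integrable (\<open>solution_not_L1\<close>).

  On the other hand the contraction compresses the whole support of \<open>n\<close> to length less than one.  For a
  given \<open>x\<close>, only the \<open>y\<close> whose translation part lies in an interval of length one contribute to the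
  integral defining \<open>S h x\<close>, which is a quarter of the mass of \<open>\<phi>\<close>.  So the kernel of \<open>S\<close> has column
  sums at most \<open>1\<close> but row sums at most \<open>1 / 4\<close>, and the norm of \<open>S\<close> on \<open>L\<^sup>2\<close> is at most \<open>1 / 2\<close> by the
  Schur test (\<open>P_L2\<close>).  This discrepancy between \<open>L\<^sup>1\<close> and \<open>L\<^sup>2\<close> rests on the group being
  non-unimodular.

  The masses are compared through strips \<open>a \<in> [1 / 32, 1 / 16], b \<in> I\<close>: their measure is positive
  and finite for \<open>I = [0, 1)\<close>, and it does not change when \<open>I\<close> is translated, since \<open>(1, t)\<close> acts on
  the left by translation of \<open>b\<close>.\<close>

section \<open>Translation by group elements and Haar measure\<close>

lemma right_inverse_group: "x * inverse x = (1 :: 'a::locally_compact_group)"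
proof -
  have "x * inverse x = (inverse (inverse x) * inverse x) * (x * inverse x)"
    by (simp add: left_inverse_group)
  also have "\<dots> = inverse (inverse x) * ((inverse x * x) * inverse x)"
    by (simp only: mult.assoc)
  finally show ?thesis
    by (simp add: left_inverse_group)
qed

lemma inverse_mult_cancel_group [simp]:
  fixes x y :: "'a::locally_compact_group"
  shows "inverse x * (x * y) = y" "x * (inverse x * y) = y"
  by (simp_all add: left_inverse_group right_inverse_group flip: mult.assoc)

lemma continuous_mult_left_group: "continuous_on UNIV (\<lambda>x::'a::locally_compact_group. y * x)"
proof -
  have "continuous_on UNIV (\<lambda>x. fst (y, x) * snd (y, x))"
    by (rule continuous_on_compose2[OF continuous_mult_group]) (auto intro!: continuous_intros)
  then show ?thesis by simp
qed

lemma continuous_inverse_group: "continuous_on UNIV (inverse :: 'a \<Rightarrow> 'a::locally_compact_group)"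
  unfolding continuous_on_UNIV_iff_nhds by (simp add: tendsto_inverse_nhds_group)

lemma measurable_mult_left_group [measurable]:
  "(\<lambda>x::'a::locally_compact_group. y * x) \<in> borel \<rightarrow>\<^sub>M borel"
  by (rule borel_measurable_continuous_onI[OF continuous_mult_left_group])

lemma measurable_inverse_mult_group [measurable (raw)]:
  fixes f g :: "'b \<Rightarrow> 'a::{locally_compact_group, second_countable_topology}"
  assumes f: "f \<in> M \<rightarrow>\<^sub>M borel" and g: "g \<in> M \<rightarrow>\<^sub>M borel"
  shows "(\<lambda>x. inverse (f x) * g x) \<in> M \<rightarrow>\<^sub>M borel"
proof -
  have "continuous_on UNIV (\<lambda>p::'a \<times> 'a. inverse (fst p))"
    by (rule continuous_on_compose2[OF continuous_inverse_group continuous_on_fst]) auto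
  then have "continuous_on UNIV (\<lambda>p::'a \<times> 'a. (inverse (fst p), snd p))"
    by (intro continuous_intros)
  from continuous_on_compose2[OF continuous_mult_group this]
  have "continuous_on UNIV (\<lambda>p::'a \<times> 'a. inverse (fst p) * snd p)"
    by simp
  from borel_measurable_continuous_Pair[OF f g this] show ?thesis
    by simp
qed

context
  fixes \<mu> :: "'a::locally_compact_group measure"
  assumes haar: "left_haar_measure \<mu>"
begin

lemma haar_sets: "sets \<mu> = sets borel"
  using haar by (simp add: left_haar_measure_def)

lemma haar_measurable: "measurable \<mu> N = measurable borel N"
  using haar_sets by (rule measurable_cong_sets) simp

lemma haar_pair_measurable: "measurable (\<mu> \<Otimes>\<^sub>M \<mu>) N = measurable (borel \<Otimes>\<^sub>M borel) N"
  by (intro measurable_cong_sets sets_pair_measure_cong haar_sets refl)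

lemma haar_pair_borel_measurable:
  "measurable (borel \<Otimes>\<^sub>M \<mu>) N = measurable (borel \<Otimes>\<^sub>M borel) N"
  by (intro measurable_cong_sets sets_pair_measure_cong haar_sets refl)

lemma haar_space [simp]: "space \<mu> = UNIV"
  using sets_eq_imp_space_eq[OF haar_sets] by simp

lemma haar_compact: "compact K \<Longrightarrow> emeasure \<mu> K < \<infinity>"
  using haar by (simp add: left_haar_measure_def)

lemma haar_translate: "A \<in> sets borel \<Longrightarrow> emeasure \<mu> ((\<lambda>y. x * y) ` A) = emeasure \<mu> A"
  using haar by (simp add: left_haar_measure_def)

lemma haar_distr: "distr \<mu> borel (\<lambda>x. y * x) = \<mu>"
proof (rule measure_eqI)
  fix A assume "A \<in> sets (distr \<mu> borel (\<lambda>x. y * x))"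
  then have A: "A \<in> sets borel" by simp
  have "(\<lambda>x. y * x) -` A = (\<lambda>x. inverse y * x) ` A"
    by (force intro: image_eqI[where x = "y * _"])
  with A haar_translate[OF A, of "inverse y"]
  show "emeasure (distr \<mu> borel (\<lambda>x. y * x)) A = emeasure \<mu> A"
    by (subst emeasure_distr) (auto simp: haar_measurable)
qed (simp add: haar_sets)

lemma haar_nn_integral_translate:
  assumes [measurable]: "u \<in> borel_measurable borel"
  shows "(\<integral>\<^sup>+ x. u (y * x) \<partial>\<mu>) = (\<integral>\<^sup>+ x. u x \<partial>\<mu>)"
proof -
  have "(\<integral>\<^sup>+ x. u x \<partial>\<mu>) = (\<integral>\<^sup>+ x. u x \<partial>distr \<mu> borel (\<lambda>x. y * x))"
    by (simp add: haar_distr)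
  then show ?thesis
    by (subst (asm) nn_integral_distr) (auto simp: haar_measurable)
qed

text \<open>If a nonempty open set were null, then so would be every compact set, being covered by
  finitely many translates, and then the whole group, by inner regularity.\<close>

lemma haar_open_pos:
  assumes "open U" "U \<noteq> {}"
  shows "emeasure \<mu> U > 0"
proof (rule ccontr)
  assume "\<not> ?thesis"
  then have U0: "emeasure \<mu> U = 0" by simp
  obtain p where p: "p \<in> U" using assms by auto
  define V where "V x = (\<lambda>z. x * z) -` U" for x
  have V: "open (V x)" "emeasure \<mu> (V x) = 0" for x
  proof -
    show "open (V x)"
      unfolding V_def by (rule open_vimage[OF assms(1) continuous_mult_left_group])
    have "V x = (\<lambda>z. inverse x * z) ` U"
      unfolding V_def by (force intro: image_eqI[where x = "x * _"])
    then show "emeasure \<mu> (V x) = 0"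
      using haar_translate[of U "inverse x"] assms(1) U0 by simp
  qed
  have "emeasure \<mu> K = 0" if K: "compact K" for K
  proof -
    have "K \<subseteq> (\<Union>x\<in>UNIV. V x)"
    proof
      fix z
      have "z \<in> V (p * inverse z)"
        using p by (simp add: V_def mult.assoc left_inverse_group)
      then show "z \<in> (\<Union>x\<in>UNIV. V x)" by blast
    qed
    then obtain F where F: "finite F" "K \<subseteq> (\<Union>x\<in>F. V x)"
      using compactE_image[OF K, of UNIV V] V(1) by metis
    have "emeasure \<mu> K \<le> emeasure \<mu> (\<Union>x\<in>F. V x)"
      using F V(1) by (intro emeasure_mono) (auto simp: haar_sets intro!: borel_open open_UN)
    also have "\<dots> \<le> (\<Sum>x\<in>F. emeasure \<mu> (V x))"
      using F V(1) by (intro emeasure_subadditive_finite) (auto simp: haar_sets)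
    finally show ?thesis using V(2) by simp
  qed
  then have "(SUP K\<in>{K. compact K \<and> K \<subseteq> UNIV}. emeasure \<mu> K) \<le> 0"
    by (intro SUP_least) simp
  moreover have "emeasure \<mu> UNIV = (SUP K\<in>{K. compact K \<and> K \<subseteq> UNIV}. emeasure \<mu> K)"
    using haar unfolding left_haar_measure_def by (meson open_UNIV)
  ultimately have "emeasure \<mu> UNIV = 0"
    by simp
  then show False
    using haar by (simp add: left_haar_measure_def)
qed

end

text \<open>By second countability, countably many relatively compact open sets cover the group.\<close>

lemma haar_sigma_finite:
  fixes \<mu> :: "'a::{locally_compact_group, second_countable_topology} measure"
  assumes haar: "left_haar_measure \<mu>"
  shows "sigma_finite_measure \<mu>"
proof
  define F :: "'a set set" where "F = {U. open U \<and> (\<exists>K. compact K \<and> U \<subseteq> K)}"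
  have "\<And>U. U \<in> F \<Longrightarrow> open U" by (simp add: F_def)
  then obtain F' where F': "F' \<subseteq> F" "countable F'" "\<Union>F' = \<Union>F"
    using Lindelof[of F] by metis
  have "x \<in> \<Union>F" for x
    using locally_compact_group[of x] unfolding F_def by blast
  then have "\<Union>F = UNIV" by blast
  moreover have "emeasure \<mu> U \<noteq> \<infinity>" if "U \<in> F" for U
  proof -
    from that have "\<exists>K. compact K \<and> U \<subseteq> K" by (simp add: F_def)
    then obtain K where "compact K" "U \<subseteq> K" by blast
    then have "emeasure \<mu> U \<le> emeasure \<mu> K"
      by (intro emeasure_mono) (auto simp: haar_sets[OF haar] borel_compact)
    then show ?thesis
      using haar_compact[OF haar \<open>compact K\<close>] by (auto simp: top_unique)
  qed
  moreover have "F' \<subseteq> sets \<mu>"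
    using F' by (auto simp: F_def haar_sets[OF haar])
  ultimately show "\<exists>A. countable A \<and> A \<subseteq> sets \<mu> \<and> \<Union>A = space \<mu> \<and> (\<forall>a\<in>A. emeasure \<mu> a \<noteq> \<infinity>)"
    using F' by (intro exI[of _ F']) (auto simp: haar_space[OF haar])
qed

text \<open>Tonelli's theorem followed by the substitution \<open>x = y * z\<close> in the inner integral.  With a weight \<open>v\<close>
  it computes both the \<open>L\<^sup>1\<close>-norm of a convolution and the part of its mass that lies in a given set.\<close>

lemma haar_convolution_swap:
  fixes \<mu> :: "'a::{locally_compact_group, second_countable_topology} measure"
  assumes haar: "left_haar_measure \<mu>"
    and [measurable]: "\<phi> \<in> borel_measurable borel" "u \<in> borel_measurable borel"
      "v \<in> borel_measurable borel"
  shows "(\<integral>\<^sup>+ x. v x * (\<integral>\<^sup>+ y. \<phi> y * u (inverse y * x) \<partial>\<mu>) \<partial>\<mu>) =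
         (\<integral>\<^sup>+ y. \<phi> y * (\<integral>\<^sup>+ z. v (y * z) * u z \<partial>\<mu>) \<partial>\<mu>)"
proof -
  interpret sigma_finite_measure \<mu> by (rule haar_sigma_finite[OF haar])
  interpret pair_sigma_finite \<mu> \<mu> ..
  have "(\<integral>\<^sup>+ x. v x * (\<integral>\<^sup>+ y. \<phi> y * u (inverse y * x) \<partial>\<mu>) \<partial>\<mu>) =
      (\<integral>\<^sup>+ x. (\<integral>\<^sup>+ y. v x * (\<phi> y * u (inverse y * x)) \<partial>\<mu>) \<partial>\<mu>)"
    by (intro nn_integral_cong nn_integral_cmult[symmetric])
      (simp_all add: haar_measurable[OF haar])
  also have "\<dots> = (\<integral>\<^sup>+ y. (\<integral>\<^sup>+ x. v x * (\<phi> y * u (inverse y * x)) \<partial>\<mu>) \<partial>\<mu>)"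
    by (rule Fubini'[symmetric], unfold haar_pair_measurable[OF haar]) measurable
  also have "\<dots> = (\<integral>\<^sup>+ y. \<phi> y * (\<integral>\<^sup>+ x. v x * u (inverse y * x) \<partial>\<mu>) \<partial>\<mu>)"
    unfolding mult.left_commute[of "v _"]
    by (intro nn_integral_cong nn_integral_cmult) (simp add: haar_measurable[OF haar])
  also have "\<dots> = (\<integral>\<^sup>+ y. \<phi> y * (\<integral>\<^sup>+ z. v (y * z) * u z \<partial>\<mu>) \<partial>\<mu>)"
  proof (rule nn_integral_cong)
    fix y
    have "(\<integral>\<^sup>+ x. v x * u (inverse y * x) \<partial>\<mu>) = (\<integral>\<^sup>+ z. v (y * z) * u (inverse y * (y * z)) \<partial>\<mu>)"
      by (rule haar_nn_integral_translate[OF haar, symmetric]) measurable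
    then show "\<phi> y * (\<integral>\<^sup>+ x. v x * u (inverse y * x) \<partial>\<mu>) = \<phi> y * (\<integral>\<^sup>+ z. v (y * z) * u z \<partial>\<mu>)"
      by simp
  qed
  finally show ?thesis .
qed

lemma haar_convolution_L1:
  fixes \<mu> :: "'a::{locally_compact_group, second_countable_topology} measure"
  assumes haar: "left_haar_measure \<mu>"
    and [measurable]: "\<phi> \<in> borel_measurable borel" "u \<in> borel_measurable borel"
  shows "(\<integral>\<^sup>+ x. \<integral>\<^sup>+ y. \<phi> y * u (inverse y * x) \<partial>\<mu> \<partial>\<mu>) =
         (\<integral>\<^sup>+ y. \<phi> y \<partial>\<mu>) * (\<integral>\<^sup>+ z. u z \<partial>\<mu>)"
proof -
  show ?thesis
    using haar_convolution_swap[OF haar, of \<phi> u "\<lambda>_. 1"]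
      nn_integral_multc[of \<phi> \<mu> "\<integral>\<^sup>+ z. u z \<partial>\<mu>"]
    by (simp add: haar_measurable[OF haar])
qed

section \<open>Coordinates on the affine group\<close>

definition dil :: "aff \<Rightarrow> real" where "dil x = Rep_aff x $ 1 $ 1"
definition trn :: "aff \<Rightarrow> real" where "trn x = Rep_aff x $ 1 $ 2"
definition mk_aff :: "real \<Rightarrow> real \<Rightarrow> aff" where "mk_aff a b = Abs_aff (aff_matrix a b)"

lemma Rep_aff_coords: "Rep_aff x = aff_matrix (dil x) (trn x)" and dil_pos [simp]: "dil x > 0"
  by (cases rule: Rep_aff_cases[of x]; simp add: dil_def trn_def)+

lemma coords_mk_aff [simp]:
  assumes "a > 0" shows "dil (mk_aff a b) = a" "trn (mk_aff a b) = b"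
proof -
  have "Rep_aff (mk_aff a b) = aff_matrix a b"
    unfolding mk_aff_def using assms by (intro Abs_aff_inverse) blast
  then show "dil (mk_aff a b) = a" "trn (mk_aff a b) = b"
    by (simp_all add: dil_def trn_def)
qed

lemma coords_mult [simp]:
  "dil (x * y) = dil x * dil y" "trn (x * y) = dil x * trn y + trn x"
  using Rep_aff_times[of x y] unfolding Rep_aff_coords[of x] Rep_aff_coords[of y] aff_matrix_mult
  by (simp_all add: dil_def trn_def)

lemma coords_inverse [simp]:
  "dil (inverse x) = 1 / dil x" "trn (inverse x) = - trn x / dil x"
  using Rep_aff_inverse'[of x] aff_matrix_inv[OF dil_pos, of x "trn x"]
  unfolding Rep_aff_coords[of x] by (simp_all add: dil_def trn_def)

lemma continuous_on_coords: "continuous_on UNIV dil" "continuous_on UNIV trn"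
  unfolding dil_def trn_def by (intro continuous_intros continuous_on_Rep_aff)+

lemma measurable_coords [measurable]:
  "dil \<in> borel_measurable borel" "trn \<in> borel_measurable borel"
  by (intro borel_measurable_continuous_onI continuous_on_coords)+

text \<open>The preimages under \<^const>\<open>Rep_aff\<close> of a countable subbasis form a countable subbasis.  Second
  countability makes the Borel sets of the product a product of Borel sets, as Tonelli's theorem
  requires.\<close>

instance aff :: second_countable_topology
proof
  obtain B :: "(real^2^2) set set" where B: "countable B" "open = generate_topology B"
    using ex_countable_subbasis by blast
  have "generate_topology ((\<lambda>V. Rep_aff -` V) ` B) (Rep_aff -` V)" if "generate_topology B V" for V
    using that
  proof induction
    case UNIV
    then show ?case by (simp add: generate_topology.UNIV)
  next
    case (Int a b)
    then show ?case by (simp add: vimage_Int generate_topology.Int)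
  next
    case (UN K)
    have "Rep_aff -` \<Union>K = \<Union>((\<lambda>V. Rep_aff -` V) ` K)" by auto
    with UN show ?case by (auto intro: generate_topology.UN)
  next
    case (Basis s)
    then show ?case by (auto intro: generate_topology.Basis)
  qed
  moreover have "open U" if "generate_topology ((\<lambda>V. Rep_aff -` V) ` B) U" for U :: "aff set"
    using that
  proof induction
    case (Basis s)
    then obtain V where V: "V \<in> B" "s = Rep_aff -` V" by auto
    then have "open V" unfolding B(2) by (intro generate_topology.Basis)
    with V show ?case unfolding open_aff_def by blast
  qed auto
  ultimately have "open = generate_topology ((\<lambda>V. Rep_aff -` V) ` B)"
    unfolding fun_eq_iff open_aff_def[abs_def] B(2)[symmetric] by (metis open_aff_def B(2))
  with B(1) show "\<exists>B :: aff set set. countable B \<and> open = generate_topology B"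
    by blast
qed

section \<open>Square integrable functions\<close>

text \<open>The squared norm as an extended number, so that no integrability has to be known beforehand.\<close>

definition L2_sq :: "'a measure \<Rightarrow> ('a \<Rightarrow> complex) \<Rightarrow> ennreal" where
  "L2_sq M h = (\<integral>\<^sup>+ x. (ennreal (norm (h x)))\<^sup>2 \<partial>M)"

lemma L2_iff: "h \<in> L2 M \<longleftrightarrow> h \<in> borel_measurable M \<and> L2_sq M h < \<infinity>"
  unfolding L2_def L2_sq_def
  by (auto simp: integrable_iff_bounded ennreal_power)

lemma L2_norm_sq: "h \<in> L2 M \<Longrightarrow> ennreal ((L2_norm M h)\<^sup>2) = L2_sq M h"
  unfolding L2_norm_def L2_sq_def L2_def
  by (simp add: ennreal_power nn_integral_eq_integral)

lemma L2_norm_leI: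
  assumes "h \<in> L2 M" "k \<in> L2 M" "L2_sq M h \<le> ennreal (c\<^sup>2) * L2_sq M k" "c \<ge> 0"
  shows "L2_norm M h \<le> c * L2_norm M k"
proof -
  have "ennreal ((L2_norm M h)\<^sup>2) \<le> ennreal ((c * L2_norm M k)\<^sup>2)"
    using assms by (simp add: L2_norm_sq[symmetric] power_mult_distrib ennreal_mult)
  then have "(L2_norm M h)\<^sup>2 \<le> (c * L2_norm M k)\<^sup>2"
    by (subst (asm) ennreal_le_iff) auto
  then show ?thesis
    by (rule power2_le_imp_le) (simp add: assms(4) L2_norm_def)
qed

lemma ennreal_add_sq_le: "(a + b)\<^sup>2 \<le> 2 * a\<^sup>2 + 2 * (b\<^sup>2 :: ennreal)"
proof (cases "a = \<infinity> \<or> b = \<infinity>")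
  case False
  then obtain r s where rs: "a = ennreal r" "b = ennreal s" "r \<ge> 0" "s \<ge> 0"
    by (metis ennreal_cases infinity_ennreal_def)
  have "(r + s)\<^sup>2 \<le> 2 * r\<^sup>2 + 2 * s\<^sup>2"
    using zero_le_power2[of "r - s"] by (simp add: power2_sum power2_diff)
  then have "ennreal ((r + s)\<^sup>2) \<le> ennreal (2 * r\<^sup>2 + 2 * s\<^sup>2)"
    by (rule ennreal_leI)
  moreover have "(a + b)\<^sup>2 = ennreal ((r + s)\<^sup>2)"
    using rs by (simp add: ennreal_power[symmetric])
  moreover have "2 * a\<^sup>2 + 2 * b\<^sup>2 = ennreal (2 * r\<^sup>2 + 2 * s\<^sup>2)"
    using rs by (simp add: ennreal_power ennreal_mult')
  ultimately show ?thesis by simp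
qed (auto simp: ennreal_mult_eq_top_iff power2_eq_square)

lemma ennreal_quarter_le: "X / 4 \<le> (X :: ennreal)"
proof (cases X)
  case (real r)
  then have "X / 4 = ennreal (r / 4)" using divide_ennreal[of r 4] by simp
  with real show ?thesis by (simp add: ennreal_leI)
qed simp

text \<open>Since \<open>(a + b)\<^sup>2 \<le> 2 * a\<^sup>2 + 2 * b\<^sup>2\<close> replaces the triangle inequality in \<open>L\<^sup>2\<close>, an operator whose
  squared norm is at most \<open>1 / 4\<close> leaves the factor \<open>2 / 4 < 1\<close>, and its contribution can be absorbed on
  the left.\<close>

lemma sq_integral_absorb:
  fixes X H :: ennreal
  assumes "X \<le> 2 * H + 2 * (X / 4)" "X < \<infinity>"
  shows "X \<le> 4 * H"
proof (cases "H = \<infinity>")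
  case False
  with assms(2) obtain r s where rs: "X = ennreal r" "H = ennreal s" "r \<ge> 0" "s \<ge> 0"
    by (metis ennreal_cases infinity_ennreal_def less_irrefl)
  have "2 * H + 2 * (X / 4) = ennreal (2 * s + 2 * (r / 4))"
  proof -
    have "X / 4 = ennreal (r / 4)"
      using rs divide_ennreal[of r 4] by simp
    moreover have "ennreal (2 * s + 2 * (r / 4)) = ennreal (2 * s) + ennreal (2 * (r / 4))"
      using rs by (intro ennreal_plus) auto
    moreover have "ennreal (2 * t) = 2 * ennreal t" for t
      by (simp add: ennreal_mult')
    ultimately show ?thesis
      using rs(2) by (simp only:)
  qed
  with assms(1) rs have "r \<le> 2 * s + 2 * (r / 4)"
    by (subst (asm) rs(1)) (simp del: ennreal_plus)
  then have "r \<le> 4 * s" by simp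
  then show ?thesis
    using rs by (simp add: ennreal_leI ennreal_mult'[symmetric] flip: ennreal_numeral)
qed (simp add: ennreal_mult_eq_top_iff)

lemma L2_sq_add_le:
  assumes [measurable]: "h \<in> borel_measurable M" "k \<in> borel_measurable M"
  shows "L2_sq M (\<lambda>x. h x + k x) \<le> 2 * L2_sq M h + 2 * L2_sq M k"
proof -
  have "L2_sq M (\<lambda>x. h x + k x) \<le>
      (\<integral>\<^sup>+ x. 2 * (ennreal (norm (h x)))\<^sup>2 + 2 * (ennreal (norm (k x)))\<^sup>2 \<partial>M)"
    unfolding L2_sq_def
  proof (rule nn_integral_mono)
    fix x
    have "(ennreal (norm (h x + k x)))\<^sup>2 \<le> (ennreal (norm (h x)) + ennreal (norm (k x)))\<^sup>2"
      by (intro power_mono) (simp_all add: ennreal_plus[symmetric] norm_triangle_ineq del: ennreal_plus)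
    also have "\<dots> \<le> 2 * (ennreal (norm (h x)))\<^sup>2 + 2 * (ennreal (norm (k x)))\<^sup>2"
      by (rule ennreal_add_sq_le)
    finally show "(ennreal (norm (h x + k x)))\<^sup>2 \<le>
      2 * (ennreal (norm (h x)))\<^sup>2 + 2 * (ennreal (norm (k x)))\<^sup>2" .
  qed
  also have "\<dots> = 2 * L2_sq M h + 2 * L2_sq M k"
    unfolding L2_sq_def by (simp add: nn_integral_add nn_integral_cmult)
  finally show ?thesis .
qed

lemma L2_sq_scale:
  assumes [measurable]: "h \<in> borel_measurable M"
  shows "L2_sq M (\<lambda>x. c * h x) = (ennreal (norm c))\<^sup>2 * L2_sq M h"
  unfolding L2_sq_def
  by (simp add: norm_mult ennreal_mult power_mult_distrib nn_integral_cmult)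

lemma L2_add: "h \<in> L2 M \<Longrightarrow> k \<in> L2 M \<Longrightarrow> (\<lambda>x. h x + k x) \<in> L2 M"
proof -
  assume *: "h \<in> L2 M" "k \<in> L2 M"
  then have "L2_sq M (\<lambda>x. h x + k x) \<le> 2 * L2_sq M h + 2 * L2_sq M k"
    by (intro L2_sq_add_le) (auto simp: L2_iff)
  also have "\<dots> < \<infinity>"
    using * by (auto simp: L2_iff ennreal_mult_less_top)
  finally show ?thesis using * by (auto simp: L2_iff)
qed

lemma L2_scale: "h \<in> L2 M \<Longrightarrow> (\<lambda>x. c * h x) \<in> L2 M"
  by (auto simp: L2_iff L2_sq_scale ennreal_mult_less_top power_less_top_ennreal)

lemma L2_diff: "h \<in> L2 M \<Longrightarrow> k \<in> L2 M \<Longrightarrow> (\<lambda>x. h x - k x) \<in> L2 M"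
  using L2_add[of h M "\<lambda>x. - 1 * k x"] L2_scale[of k M "- 1"] by simp

lemma L2_sq_zero_AE:
  assumes "h \<in> borel_measurable M" "L2_sq M h = 0"
  shows "AE x in M. h x = 0"
proof -
  have "AE x in M. (ennreal (norm (h x)))\<^sup>2 = 0"
    using assms unfolding L2_sq_def by (subst (asm) nn_integral_0_iff_AE) auto
  then show ?thesis by eventually_elim simp
qed

lemma L2_sq_mono_AE:
  "AE x in M. norm (h x) \<le> norm (k x) \<Longrightarrow> L2_sq M h \<le> L2_sq M k"
  unfolding L2_sq_def
  by (intro nn_integral_mono_AE) (auto intro!: power_mono ennreal_leI elim!: eventually_mono)

section \<open>Twisted convolution operators that are small on $L^2$\<close>

text \<open>For the kernel \<open>k x y = \<phi> y * n (inverse y * x)\<close>, the last assumption bounds the row sums.  The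
  column sums are at most one because \<open>\<phi>\<close> has mass at most one and \<open>n \<le> 1\<close>.\<close>

locale small_convolution =
  fixes \<mu> :: "'a::{locally_compact_group, second_countable_topology} measure"
    and \<phi> n :: "'a \<Rightarrow> real"
  assumes haar: "left_haar_measure \<mu>"
    and \<phi> [measurable]: "\<phi> \<in> borel_measurable borel" and \<phi>_nonneg: "\<phi> x \<ge> 0"
    and n [measurable]: "n \<in> borel_measurable borel" and n_nonneg: "n x \<ge> 0" and n_le: "n x \<le> 1"
    and \<phi>_mass: "(\<integral>\<^sup>+ y. ennreal (\<phi> y) \<partial>\<mu>) \<le> 1"
    and row_mass: "(\<integral>\<^sup>+ y. ennreal (\<phi> y * n (inverse y * x)) \<partial>\<mu>) \<le> 1 / 4"
begin

sublocale sigma_finite_measure \<mu> by (rule haar_sigma_finite[OF haar])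

text \<open>The operator \<open>P\<close> has the same kernel as \<open>S\<close> but acts on functions with values in \<open>[0, \<infinity>]\<close>, where
  all integrals exist; it dominates \<open>S\<close> pointwise.\<close>

definition P :: "('a \<Rightarrow> ennreal) \<Rightarrow> 'a \<Rightarrow> ennreal" where
  "P u x = (\<integral>\<^sup>+ y. ennreal (\<phi> y * n (inverse y * x)) * u (inverse y * x) \<partial>\<mu>)"

definition S :: "'a operator" where
  "S h x = (\<integral>y. complex_of_real (\<phi> y * n (inverse y * x)) * h (inverse y * x) \<partial>\<mu>)"

lemmas meas = haar_measurable[OF haar] haar_pair_borel_measurable[OF haar]

lemma P_measurable [measurable]:
  assumes [measurable]: "u \<in> borel_measurable borel"
  shows "P u \<in> borel_measurable borel"
  unfolding P_def by (rule borel_measurable_nn_integral, unfold meas) measurable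

lemma S_measurable [measurable]:
  assumes [measurable]: "h \<in> borel_measurable borel"
  shows "S h \<in> borel_measurable borel"
  unfolding S_def by (rule borel_measurable_lebesgue_integral, unfold meas) measurable

lemma P_mono: "(\<And>x. u x \<le> v x) \<Longrightarrow> P u x \<le> P v x"
  unfolding P_def by (intro nn_integral_mono mult_left_mono) auto

text \<open>The Schur test: the kernel has row sums at most \<open>1 / 4\<close> and column sums at most \<open>1\<close>.\<close>

lemma P_L2:
  assumes [measurable]: "u \<in> borel_measurable borel"
  shows "(\<integral>\<^sup>+ x. (P u x)\<^sup>2 \<partial>\<mu>) \<le> (\<integral>\<^sup>+ x. (u x)\<^sup>2 \<partial>\<mu>) / 4"
proof -
  have "(P u x)\<^sup>2 \<le> (1 / 4) * (\<integral>\<^sup>+ y. ennreal (\<phi> y) * (u (inverse y * x))\<^sup>2 \<partial>\<mu>)" for x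
  proof -
    \<comment> \<open>Split the kernel as a product of square roots and apply the Cauchy--Schwarz inequality.\<close>
    define f where "f y = ennreal (sqrt (\<phi> y * n (inverse y * x)))" for y
    have [measurable]: "f \<in> borel_measurable borel" unfolding f_def by measurable
    have f2: "(f y)\<^sup>2 = ennreal (\<phi> y * n (inverse y * x))" for y
      using \<phi>_nonneg n_nonneg by (simp add: f_def ennreal_power)
    have "P u x = (\<integral>\<^sup>+ y. f y * (f y * u (inverse y * x)) \<partial>\<mu>)"
      unfolding P_def by (simp add: f2[symmetric] power2_eq_square mult.assoc)
    then have "(P u x)\<^sup>2 \<le>
        (\<integral>\<^sup>+ y. (f y)\<^sup>2 \<partial>\<mu>) * (\<integral>\<^sup>+ y. (f y * u (inverse y * x))\<^sup>2 \<partial>\<mu>)"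
      by (simp only:) (rule Cauchy_Schwarz_nn_integral; simp only: meas; measurable)
    also have "\<dots> \<le> (1 / 4) * (\<integral>\<^sup>+ y. ennreal (\<phi> y) * (u (inverse y * x))\<^sup>2 \<partial>\<mu>)"
    proof (intro mult_mono nn_integral_mono)
      show "(\<integral>\<^sup>+ y. (f y)\<^sup>2 \<partial>\<mu>) \<le> 1 / 4"
        using row_mass by (simp add: f2)
      fix y
      have "\<phi> y * n (inverse y * x) \<le> \<phi> y"
        using \<phi>_nonneg n_le by (simp add: mult_left_le)
      then show "(f y * u (inverse y * x))\<^sup>2 \<le> ennreal (\<phi> y) * (u (inverse y * x))\<^sup>2"
        unfolding power_mult_distrib f2 by (intro mult_right_mono ennreal_leI) auto
    qed auto
    finally show ?thesis .
  qed
  then have "(\<integral>\<^sup>+ x. (P u x)\<^sup>2 \<partial>\<mu>) \<le>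
      (\<integral>\<^sup>+ x. (1 / 4) * (\<integral>\<^sup>+ y. ennreal (\<phi> y) * (u (inverse y * x))\<^sup>2 \<partial>\<mu>) \<partial>\<mu>)"
    by (intro nn_integral_mono)
  also have "\<dots> = (\<integral>\<^sup>+ y. ennreal (\<phi> y) * (\<integral>\<^sup>+ z. (1 / 4) * (u z)\<^sup>2 \<partial>\<mu>) \<partial>\<mu>)"
    by (rule haar_convolution_swap[OF haar]) measurable
  also have "\<dots> = (\<integral>\<^sup>+ y. ennreal (\<phi> y) \<partial>\<mu>) * ((1 / 4) * (\<integral>\<^sup>+ z. (u z)\<^sup>2 \<partial>\<mu>))"
    by (simp add: nn_integral_multc nn_integral_cmult meas)
  also have "\<dots> \<le> 1 * ((1 / 4) * (\<integral>\<^sup>+ z. (u z)\<^sup>2 \<partial>\<mu>))"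
    by (intro mult_right_mono \<phi>_mass) auto
  finally show ?thesis
    by (simp add: divide_ennreal_def mult.commute)
qed

lemma S_bound:
  assumes [measurable]: "h \<in> borel_measurable borel"
  shows "ennreal (norm (S h x)) \<le> P (\<lambda>z. ennreal (norm (h z))) x"
    and "P (\<lambda>z. ennreal (norm (h z))) x < \<infinity> \<Longrightarrow>
      integrable \<mu> (\<lambda>y. complex_of_real (\<phi> y * n (inverse y * x)) * h (inverse y * x))"
proof -
  let ?g = "\<lambda>y. complex_of_real (\<phi> y * n (inverse y * x)) * h (inverse y * x)"
  have eq: "P (\<lambda>z. ennreal (norm (h z))) x = (\<integral>\<^sup>+ y. ennreal (norm (?g y)) \<partial>\<mu>)"
    unfolding P_def using \<phi>_nonneg n_nonneg
    by (intro nn_integral_cong) (simp add: norm_mult ennreal_mult abs_mult)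
  show *: "integrable \<mu> ?g" if "P (\<lambda>z. ennreal (norm (h z))) x < \<infinity>"
    using that unfolding eq by (subst integrable_iff_bounded) (simp add: meas)
  show "ennreal (norm (S h x)) \<le> P (\<lambda>z. ennreal (norm (h z))) x"
  proof (cases "P (\<lambda>z. ennreal (norm (h z))) x < \<infinity>")
    case True
    then show ?thesis
      unfolding S_def eq using * by (intro integral_norm_bound_ennreal) (simp add: eq)
  qed (simp add: not_less top_unique)
qed

lemma borel_of_L2: "h \<in> L2 \<mu> \<Longrightarrow> h \<in> borel_measurable borel"
  by (simp add: L2_iff meas)

lemma S_L2_sq: "h \<in> borel_measurable borel \<Longrightarrow> L2_sq \<mu> (S h) \<le> L2_sq \<mu> h / 4"
  unfolding L2_sq_def
  by (rule order_trans[OF nn_integral_mono[OF power_mono[OF S_bound(1)]] P_L2]) auto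

lemma S_L2: "h \<in> L2 \<mu> \<Longrightarrow> S h \<in> L2 \<mu>"
  using S_L2_sq[of h] by (auto simp: L2_iff meas ennreal_divide_eq_top_iff less_top[symmetric] top_unique)

lemma P_finite_AE:
  assumes "u \<in> borel_measurable borel" "(\<integral>\<^sup>+ x. (u x)\<^sup>2 \<partial>\<mu>) < \<infinity>"
  shows "AE x in \<mu>. P u x < \<infinity>"
proof -
  have "AE x in \<mu>. (P u x)\<^sup>2 \<noteq> \<infinity>"
  proof (rule nn_integral_PInf_AE)
    show "(\<lambda>x. (P u x)\<^sup>2) \<in> borel_measurable \<mu>" using assms by (simp add: meas)
    show "(\<integral>\<^sup>+ x. (P u x)\<^sup>2 \<partial>\<mu>) \<noteq> \<infinity>"
      using P_L2[OF assms(1)] assms(2)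
      by (auto simp: top_unique ennreal_divide_eq_top_iff)
  qed
  then show ?thesis
    by eventually_elim (auto simp: less_top power2_eq_square ennreal_mult_eq_top_iff)
qed

lemma S_integrable_AE:
  assumes "h \<in> L2 \<mu>"
  shows "AE x in \<mu>. integrable \<mu>
    (\<lambda>y. complex_of_real (\<phi> y * n (inverse y * x)) * h (inverse y * x))"
proof -
  note [measurable] = borel_of_L2[OF assms]
  have "AE x in \<mu>. P (\<lambda>z. ennreal (norm (h z))) x < \<infinity>"
    using assms by (intro P_finite_AE) (auto simp: L2_iff L2_sq_def)
  then show ?thesis
    by eventually_elim (rule S_bound(2)[OF borel_of_L2[OF assms]])
qed

lemma S_add_AE:
  assumes "h \<in> L2 \<mu>" "k \<in> L2 \<mu>"
  shows "AE x in \<mu>. S (\<lambda>z. h z + k z) x = S h x + S k x"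
  using S_integrable_AE[OF assms(1)] S_integrable_AE[OF assms(2)]
  by eventually_elim (simp add: S_def distrib_left)

lemma S_scale: "S (\<lambda>z. c * h z) x = c * S h x"
proof -
  have "S (\<lambda>z. c * h z) x =
      (\<integral>y. c * (complex_of_real (\<phi> y * n (inverse y * x)) * h (inverse y * x)) \<partial>\<mu>)"
    unfolding S_def by (simp add: mult_ac)
  then show ?thesis by (simp add: S_def)
qed

definition solves :: "('a \<Rightarrow> complex) \<Rightarrow> ('a \<Rightarrow> complex) \<Rightarrow> bool" where
  "solves u h \<longleftrightarrow> u \<in> L2 \<mu> \<and> (AE x in \<mu>. u x - S u x = h x)"

lemma solves_add:
  assumes "solves u h" "solves v k"
  shows "solves (\<lambda>x. u x + v x) (\<lambda>x. h x + k x)"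
proof -
  have "AE x in \<mu>. (u x + v x) - S (\<lambda>x. u x + v x) x = h x + k x"
    using assms S_add_AE[of u v] unfolding solves_def
    by (auto elim!: eventually_elim2 simp: algebra_simps)
  then show ?thesis using assms by (auto simp: solves_def L2_add)
qed

lemma solves_scale:
  assumes "solves u h"
  shows "solves (\<lambda>x. c * u x) (\<lambda>x. c * h x)"
  using assms unfolding solves_def
  by (auto simp: L2_scale S_scale right_diff_distrib[symmetric] elim!: eventually_mono)

text \<open>This a priori estimate gives uniqueness of solutions and the boundedness of the solution operator.\<close>

lemma solves_bound:
  assumes "solves u h" "h \<in> L2 \<mu>"
  shows "L2_sq \<mu> u \<le> 4 * L2_sq \<mu> h"
proof (rule sq_integral_absorb)
  have u: "u \<in> L2 \<mu>" using assms by (simp add: solves_def)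
  then show "L2_sq \<mu> u < \<infinity>" by (simp add: L2_iff)
  have "AE x in \<mu>. norm (u x) \<le> norm (h x + S u x)"
    using assms unfolding solves_def by (auto elim!: eventually_mono simp: diff_eq_eq)
  then have "L2_sq \<mu> u \<le> L2_sq \<mu> (\<lambda>x. h x + S u x)"
    by (rule L2_sq_mono_AE)
  also have "\<dots> \<le> 2 * L2_sq \<mu> h + 2 * L2_sq \<mu> (S u)"
    using assms(2) u S_L2 by (intro L2_sq_add_le) (auto simp: L2_iff)
  also have "\<dots> \<le> 2 * L2_sq \<mu> h + 2 * (L2_sq \<mu> u / 4)"
    by (intro add_mono mult_left_mono S_L2_sq borel_of_L2 u) auto
  finally show "L2_sq \<mu> u \<le> 2 * L2_sq \<mu> h + 2 * (L2_sq \<mu> u / 4)" .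
qed

lemma solves_unique:
  assumes "solves u h" "solves v h"
  shows "AE x in \<mu>. u x = v x"
proof -
  have "solves (\<lambda>x. u x + (- 1) * v x) (\<lambda>x. h x + (- 1) * h x)"
    by (intro solves_add solves_scale assms)
  then have s: "solves (\<lambda>x. u x - v x) (\<lambda>x. 0)" by simp
  have "L2_sq \<mu> (\<lambda>x. u x - v x) \<le> 4 * L2_sq \<mu> (\<lambda>x. 0)"
    by (rule solves_bound[OF s]) (simp add: L2_iff L2_sq_def)
  then have "L2_sq \<mu> (\<lambda>x. u x - v x) = 0"
    by (simp add: L2_sq_def)
  with s have "AE x in \<mu>. u x - v x = 0"
    by (intro L2_sq_zero_AE) (auto simp: solves_def L2_iff)
  then show ?thesis by simp
qed

text \<open>The partial sums of the Neumann series of a nonnegative function increase, so they converge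
  pointwise in \<open>[0, \<infinity>]\<close>.  Their squared norms are bounded by the absorption argument, and Fatou's lemma
  passes the bound to the limit.\<close>

lemma fixed_point_exists:
  assumes [measurable]: "h \<in> borel_measurable borel" and h: "(\<integral>\<^sup>+ x. (h x)\<^sup>2 \<partial>\<mu>) < \<infinity>"
  obtains G where "G \<in> borel_measurable borel" "\<And>x. G x = h x + P G x"
    "(\<integral>\<^sup>+ x. (G x)\<^sup>2 \<partial>\<mu>) < \<infinity>"
proof -
  define g where "g k = ((\<lambda>u x. h x + P u x) ^^ k) (\<lambda>_. 0)" for k
  have g_0: "g 0 = (\<lambda>_. 0)" and g_Suc: "g (Suc k) = (\<lambda>x. h x + P (g k) x)" for k
    by (simp_all add: g_def)
  have g_meas [measurable]: "g k \<in> borel_measurable borel" for k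
    by (induction k) (simp_all add: g_0 g_Suc)
  have g_step: "g k x \<le> g (Suc k) x" for k x
  proof (induction k arbitrary: x)
    case 0
    then show ?case by (simp add: g_0)
  next
    case (Suc k)
    then show ?case
      unfolding g_Suc[of k] g_Suc[of "Suc k"] by (intro add_left_mono P_mono)
  qed
  then have inc: "incseq g"
    by (simp add: incseq_Suc_iff le_fun_def)
  let ?H = "\<integral>\<^sup>+ x. (h x)\<^sup>2 \<partial>\<mu>"
  define X where "X k = (\<integral>\<^sup>+ x. (g k x)\<^sup>2 \<partial>\<mu>)" for k
  have X_Suc: "X (Suc k) \<le> 2 * ?H + 2 * (X k / 4)" for k
  proof -
    have "X (Suc k) \<le> (\<integral>\<^sup>+ x. 2 * (h x)\<^sup>2 + 2 * (P (g k) x)\<^sup>2 \<partial>\<mu>)"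
      unfolding X_def g_Suc by (intro nn_integral_mono ennreal_add_sq_le)
    also have "\<dots> = 2 * ?H + 2 * (\<integral>\<^sup>+ x. (P (g k) x)\<^sup>2 \<partial>\<mu>)"
      by (simp add: nn_integral_add nn_integral_cmult meas)
    also have "\<dots> \<le> 2 * ?H + 2 * (X k / 4)"
      unfolding X_def by (intro add_left_mono mult_left_mono P_L2) auto
    finally show ?thesis .
  qed
  have X_bound: "X k \<le> 4 * ?H" for k
  proof (induction k)
    case 0
    then show ?case by (simp add: X_def g_0)
  next
    case (Suc k)
    then have fin: "X k < \<infinity>"
      using h by (auto simp: ennreal_mult_less_top elim: le_less_trans)
    have "X (Suc k) \<le> 2 * ?H + 2 * (X k / 4)" by (rule X_Suc)
    also have "\<dots> < \<infinity>"
      using le_less_trans[OF ennreal_quarter_le fin] h by (simp add: ennreal_mult_less_top)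
    finally have "X (Suc k) < \<infinity>" .
    moreover have "X (Suc k) \<le> 2 * ?H + 2 * (X (Suc k) / 4)"
    proof -
      have "X k \<le> X (Suc k)"
        unfolding X_def by (intro nn_integral_mono power_mono g_step) simp
      then show ?thesis
        by (intro order_trans[OF X_Suc] add_left_mono mult_left_mono divide_right_mono_ennreal) auto
    qed
    ultimately show ?case by (rule sq_integral_absorb[rotated])
  qed
  define G where "G x = (SUP k. g k x)" for x
  have [measurable]: "G \<in> borel_measurable borel" unfolding G_def by measurable
  have P_SUP: "P G x = (SUP k. P (g k) x)" for x
  proof -
    have "P G x = (\<integral>\<^sup>+ y. (SUP k. ennreal (\<phi> y * n (inverse y * x)) * g k (inverse y * x)) \<partial>\<mu>)"
      unfolding P_def G_def by (simp add: SUP_mult_left_ennreal)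
    also have "\<dots> = (SUP k. P (g k) x)"
      unfolding P_def
    proof (rule nn_integral_monotone_convergence_SUP)
      show "incseq (\<lambda>k y. ennreal (\<phi> y * n (inverse y * x)) * g k (inverse y * x))"
        using g_step by (auto simp: incseq_Suc_iff le_fun_def intro!: mult_left_mono)
    qed (simp add: meas)
    finally show ?thesis .
  qed
  have "G x = h x + P G x" for x
  proof -
    have "G x = (SUP k. g (Suc k) x)"
      unfolding G_def using inc
      by (intro antisym SUP_mono) (auto intro: g_step)
    also have "\<dots> = h x + P G x"
      unfolding g_Suc P_SUP by (simp add: ennreal_SUP_add_right)
    finally show ?thesis .
  qed
  moreover have "(\<integral>\<^sup>+ x. (G x)\<^sup>2 \<partial>\<mu>) < \<infinity>"
  proof -
    have lim: "(\<lambda>k. (g k x)\<^sup>2) \<longlonglongrightarrow> (G x)\<^sup>2" for x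
    proof -
      have "incseq (\<lambda>k. g k x)" using inc by (simp add: incseq_def le_fun_def)
      then have "(\<lambda>k. g k x) \<longlonglongrightarrow> G x" unfolding G_def by (rule LIMSEQ_SUP)
      then show ?thesis
        unfolding power2_eq_square by (intro tendsto_mult_ennreal) auto
    qed
    have "(\<integral>\<^sup>+ x. (G x)\<^sup>2 \<partial>\<mu>) = (\<integral>\<^sup>+ x. liminf (\<lambda>k. (g k x)\<^sup>2) \<partial>\<mu>)"
      by (intro nn_integral_cong) (simp add: lim_imp_Liminf[OF _ lim])
    also have "\<dots> \<le> liminf (\<lambda>k. X k)"
      unfolding X_def by (rule nn_integral_liminf) (simp add: meas)
    also have "\<dots> \<le> 4 * ?H"
      by (rule Liminf_le) (auto simp: X_bound)
    finally show ?thesis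
      using h by (auto simp: ennreal_mult_less_top elim: le_less_trans)
  qed
  ultimately show thesis using that \<open>G \<in> borel_measurable borel\<close> by blast
qed

text \<open>The fixed point is finite almost everywhere, and its real version agrees with it outside a null set
  to which \<open>P\<close> is insensitive by the bound in \<open>L\<^sup>2\<close>.  Both versions are returned: the solution in
  \<open>L\<^sup>2\<close>, and the extended fixed point whose integral can be shown to be infinite.\<close>

lemma solves_nonneg:
  assumes r: "r \<in> borel_measurable borel" "\<And>x. r x \<ge> 0" and h: "(\<lambda>x. complex_of_real (r x)) \<in> L2 \<mu>"
  obtains G where "G \<in> borel_measurable borel" "\<And>x. G x = ennreal (r x) + P G x"
    "solves (\<lambda>x. complex_of_real (enn2real (G x))) (\<lambda>x. complex_of_real (r x))"
    "AE x in \<mu>. G x < \<infinity>"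
proof -
  note r(1) [measurable]
  have "(\<integral>\<^sup>+ x. (ennreal (r x))\<^sup>2 \<partial>\<mu>) < \<infinity>"
    using h r(2) by (simp add: L2_iff L2_sq_def)
  then obtain G where [measurable]: "G \<in> borel_measurable borel" and G: "\<And>x. G x = ennreal (r x) + P G x"
    and G2: "(\<integral>\<^sup>+ x. (G x)\<^sup>2 \<partial>\<mu>) < \<infinity>"
    using fixed_point_exists[of "\<lambda>x. ennreal (r x)"] by auto
  define u where "u x = enn2real (G x)" for x
  have [measurable]: "u \<in> borel_measurable borel" unfolding u_def by measurable
  have fin: "AE x in \<mu>. P G x < \<infinity>" by (rule P_finite_AE[OF _ G2]) simp
  then have finG: "AE x in \<mu>. G x < \<infinity>"
    by eventually_elim (subst G, simp)
  have u_le: "ennreal (u x) \<le> G x" for x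
    by (cases "G x") (auto simp: u_def)
  have uL2: "(\<lambda>x. complex_of_real (u x)) \<in> L2 \<mu>"
  proof -
    have "L2_sq \<mu> (\<lambda>x. complex_of_real (u x)) \<le> (\<integral>\<^sup>+ x. (G x)\<^sup>2 \<partial>\<mu>)"
      unfolding L2_sq_def by (intro nn_integral_mono power_mono) (auto simp: u_def u_le[unfolded u_def])
    then show ?thesis using G2 by (auto simp: L2_iff meas)
  qed
  have diff0: "AE x in \<mu>. P (\<lambda>z. G z - ennreal (u z)) x = 0"
  proof -
    have "AE x in \<mu>. (G x - ennreal (u x))\<^sup>2 = 0"
      using finG by eventually_elim (simp add: u_def)
    then have "(\<integral>\<^sup>+ x. (G x - ennreal (u x))\<^sup>2 \<partial>\<mu>) = 0"
      by (subst nn_integral_0_iff_AE) (auto simp: meas)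
    with P_L2[of "\<lambda>z. G z - ennreal (u z)"]
    have "(\<integral>\<^sup>+ x. (P (\<lambda>z. G z - ennreal (u z)) x)\<^sup>2 \<partial>\<mu>) = 0" by simp
    then have "AE x in \<mu>. (P (\<lambda>z. G z - ennreal (u z)) x)\<^sup>2 = 0"
      by (subst (asm) nn_integral_0_iff_AE) (auto simp: meas)
    then show ?thesis by eventually_elim simp
  qed
  have "AE x in \<mu>. complex_of_real (u x) - S (\<lambda>x. complex_of_real (u x)) x = complex_of_real (r x)"
    using fin finG diff0
  proof eventually_elim
    case (elim x)
    have "P G x = P (\<lambda>z. ennreal (u z) + (G z - ennreal (u z))) x"
      using u_le by (simp add: add_diff_inverse_ennreal)
    also have "\<dots> = P (\<lambda>z. ennreal (u z)) x + P (\<lambda>z. G z - ennreal (u z)) x"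
      unfolding P_def by (simp add: distrib_left nn_integral_add meas)
    finally have PG: "P G x = P (\<lambda>z. ennreal (u z)) x" using elim by simp
    have "S (\<lambda>x. complex_of_real (u x)) x = 
        complex_of_real (\<integral>y. \<phi> y * n (inverse y * x) * u (inverse y * x) \<partial>\<mu>)"
      unfolding S_def by (simp flip: integral_complex_of_real)
    also have "(\<integral>y. \<phi> y * n (inverse y * x) * u (inverse y * x) \<partial>\<mu>) = 
        enn2real (P (\<lambda>z. ennreal (u z)) x)"
      unfolding P_def using \<phi>_nonneg n_nonneg
      by (subst integral_eq_nn_integral) (auto simp: meas u_def ennreal_mult)
    also have "\<dots> = enn2real (P G x)"
      by (simp only: PG)
    also have "\<dots> = u x - r x"
      using elim r(2)[of x] G[of x] unfolding u_def
      by (cases "P G x") (auto simp: enn2real_plus)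
    finally show ?case by simp
  qed
  with uL2 have "solves (\<lambda>x. complex_of_real (enn2real (G x))) (\<lambda>x. complex_of_real (r x))"
    by (simp add: solves_def u_def)
  with that[OF _ G _ finG] show thesis by simp
qed

text \<open>A complex function is a combination of four nonnegative ones of no larger modulus.\<close>

lemma solves_exists:
  assumes h: "h \<in> L2 \<mu>"
  shows "\<exists>u. solves u h"
proof -
  note [measurable] = borel_of_L2[OF h]
  have *: "\<exists>u. solves u (\<lambda>x. complex_of_real (r x))"
    if [measurable]: "r \<in> borel_measurable borel" and r: "\<And>x. r x \<ge> 0" "\<And>x. r x \<le> norm (h x)" for r
  proof -
    have "L2_sq \<mu> (\<lambda>x. complex_of_real (r x)) \<le> L2_sq \<mu> h"
      by (rule L2_sq_mono_AE) (auto simp: r)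
    then have "(\<lambda>x. complex_of_real (r x)) \<in> L2 \<mu>"
      using h by (auto simp: L2_iff meas)
    then show ?thesis
      using solves_nonneg[of r] r by (metis that(1))
  qed
  have Re: "max 0 (Re z) \<le> norm z" "max 0 (- Re z) \<le> norm z"
    "max 0 (Im z) \<le> norm z" "max 0 (- Im z) \<le> norm z" for z
    using abs_Re_le_cmod[of z] abs_Im_le_cmod[of z] by auto
  obtain a b c d where abcd: "solves a (\<lambda>x. complex_of_real (max 0 (Re (h x))))"
    "solves b (\<lambda>x. complex_of_real (max 0 (- Re (h x))))"
    "solves c (\<lambda>x. complex_of_real (max 0 (Im (h x))))"
    "solves d (\<lambda>x. complex_of_real (max 0 (- Im (h x))))"
    using *[of "\<lambda>x. max 0 (Re (h x))"] *[of "\<lambda>x. max 0 (- Re (h x))"]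
      *[of "\<lambda>x. max 0 (Im (h x))"] *[of "\<lambda>x. max 0 (- Im (h x))"] Re
    by (auto simp del: max.bounded_iff)
  have "solves (\<lambda>x. (a x + (- 1) * b x) + (\<i> * c x + (- \<i>) * d x))
     (\<lambda>x. (complex_of_real (max 0 (Re (h x))) + (- 1) * complex_of_real (max 0 (- Re (h x)))) +
       (\<i> * complex_of_real (max 0 (Im (h x))) + (- \<i>) * complex_of_real (max 0 (- Im (h x)))))"
    by (intro solves_add solves_scale abcd)
  also have "(\<lambda>x. (complex_of_real (max 0 (Re (h x))) + (- 1) * complex_of_real (max 0 (- Re (h x)))) +
       (\<i> * complex_of_real (max 0 (Im (h x))) + (- \<i>) * complex_of_real (max 0 (- Im (h x))))) = h"
    by (rule ext) (auto simp: complex_eq_iff max_def)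
  finally show ?thesis by blast
qed

lemma minus_S_L2: "h \<in> L2 \<mu> \<Longrightarrow> (\<lambda>x. - S h x) \<in> L2 \<mu>"
  using L2_scale[OF S_L2, of h "- 1"] by simp

lemma minus_S_in_B_L2: "(\<lambda>h x. - S h x) \<in> B_L2 \<mu>"
  unfolding B_L2_def
proof (intro CollectI conjI ballI allI)
  fix h k assume hk: "h \<in> L2 \<mu>" "k \<in> L2 \<mu>"
  show "AE x in \<mu>. - S (\<lambda>z. h z + k z) x = - S h x + - S k x"
    using S_add_AE[OF hk] by eventually_elim simp
next
  show "\<exists>C. \<forall>h\<in>L2 \<mu>. L2_norm \<mu> (\<lambda>x. - S h x) \<le> C * L2_norm \<mu> h"
  proof (intro exI[of _ 1] ballI L2_norm_leI minus_S_L2)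
    fix h assume "h \<in> L2 \<mu>"
    then have "L2_sq \<mu> (S h) \<le> L2_sq \<mu> h"
      using order_trans[OF S_L2_sq[OF borel_of_L2] ennreal_quarter_le] by blast
    then show "L2_sq \<mu> (\<lambda>x. - S h x) \<le> ennreal (1\<^sup>2) * L2_sq \<mu> h"
      by (simp add: L2_sq_def)
  qed auto
qed (auto simp: minus_S_L2 S_scale)

lemma id_minus_S_in_B_L2: "(\<lambda>h x. h x - S h x) \<in> B_L2 \<mu>"
  unfolding B_L2_def
proof (intro CollectI conjI ballI allI)
  fix h k assume hk: "h \<in> L2 \<mu>" "k \<in> L2 \<mu>"
  show "AE x in \<mu>. h x + k x - S (\<lambda>z. h z + k z) x = h x - S h x + (k x - S k x)"
    using S_add_AE[OF hk] by eventually_elim simp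
next
  show "\<exists>C. \<forall>h\<in>L2 \<mu>. L2_norm \<mu> (\<lambda>x. h x - S h x) \<le> C * L2_norm \<mu> h"
  proof (intro exI[of _ 2] ballI L2_norm_leI L2_diff S_L2)
    fix h assume h: "h \<in> L2 \<mu>"
    have "L2_sq \<mu> (\<lambda>x. h x + (- 1) * S h x) \<le>
        2 * L2_sq \<mu> h + 2 * L2_sq \<mu> (\<lambda>x. (- 1) * S h x)"
      using h S_L2[OF h] L2_scale[OF S_L2[OF h], of "- 1"] by (intro L2_sq_add_le) (auto simp: L2_iff)
    also have "L2_sq \<mu> (\<lambda>x. (- 1) * S h x) \<le> L2_sq \<mu> h / 4"
      using S_L2_sq[OF borel_of_L2[OF h]] by (simp add: L2_sq_def)
    also have "L2_sq \<mu> h / 4 \<le> L2_sq \<mu> h"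
      by (rule ennreal_quarter_le)
    finally show "L2_sq \<mu> (\<lambda>x. h x - S h x) \<le> ennreal (2\<^sup>2) * L2_sq \<mu> h"
      by (simp add: add_left_mono mult_left_mono distrib_right[symmetric])
  qed auto
qed (auto simp: L2_diff S_L2 S_scale right_diff_distrib)

text \<open>Since solutions are unique up to null sets, an arbitrary choice of solutions is linear almost
  everywhere.\<close>

lemma id_minus_S_invertible: "invertible_in \<mu> (B_L2 \<mu>) (\<lambda>h x. h x - S h x)"
proof -
  define V where "V h = (SOME u. solves u h)" for h
  have V: "solves (V h) h" if "h \<in> L2 \<mu>" for h
    unfolding V_def using solves_exists[OF that] by (rule someI_ex)
  then have V_L2: "V h \<in> L2 \<mu>" if "h \<in> L2 \<mu>" for h
    using that by (simp add: solves_def)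
  have "V \<in> B_L2 \<mu>"
    unfolding B_L2_def
  proof (intro CollectI conjI ballI allI)
    fix h k c assume hk: "h \<in> L2 \<mu>" "k \<in> L2 \<mu>"
    show "AE x in \<mu>. V (\<lambda>z. h z + k z) x = V h x + V k x"
      using hk by (intro solves_unique[OF V solves_add[OF V V]] L2_add)
  next
    fix h c assume h: "h \<in> L2 \<mu>"
    show "AE x in \<mu>. V (\<lambda>z. c * h z) x = c * V h x"
      using h by (intro solves_unique[OF V solves_scale[OF V]] L2_scale)
  next
    show "\<exists>C. \<forall>h\<in>L2 \<mu>. L2_norm \<mu> (V h) \<le> C * L2_norm \<mu> h"
      using solves_bound[OF V] V_L2 by (intro exI[of _ 2] ballI L2_norm_leI) auto
  qed (rule V_L2)
  moreover have "op_eq \<mu> (V \<circ> (\<lambda>h x. h x - S h x)) id"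
    unfolding op_eq_def
  proof
    fix h assume h: "h \<in> L2 \<mu>"
    then have "(\<lambda>x. h x - S h x) \<in> L2 \<mu>" by (intro L2_diff S_L2)
    from solves_unique[OF V[OF this]] h
    show "AE x in \<mu>. (V \<circ> (\<lambda>h x. h x - S h x)) h x = id h x"
      by (simp add: solves_def)
  qed
  moreover have "op_eq \<mu> ((\<lambda>h x. h x - S h x) \<circ> V) id"
    unfolding op_eq_def using V by (simp add: solves_def)
  ultimately show ?thesis
    unfolding invertible_in_def by blast
qed

end

section \<open>Solutions that are not integrable\<close>

context small_convolution
begin

text \<open>All the mass of \<open>u\<close> on \<open>E\<close> is carried by \<open>P\<close> into \<open>E\<close>, as left multiplication by points
  of the support of \<open>\<phi>\<close> maps \<open>E\<close> into itself and \<open>n\<close> does not attenuate on \<open>E\<close>.\<close>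

lemma L1_growth:
  assumes [measurable]: "E \<in> sets borel" "u \<in> borel_measurable borel"
    and mass: "(\<integral>\<^sup>+ y. ennreal (\<phi> y) \<partial>\<mu>) = 1"
    and E: "\<And>y z. \<phi> y \<noteq> 0 \<Longrightarrow> z \<in> E \<Longrightarrow> y * z \<in> E" "\<And>z. z \<in> E \<Longrightarrow> n z = 1"
  shows "(\<integral>\<^sup>+ x. indicator E x * u x \<partial>\<mu>) \<le> (\<integral>\<^sup>+ x. indicator E x * P u x \<partial>\<mu>)"
proof -
  have "(\<integral>\<^sup>+ x. indicator E x * u x \<partial>\<mu>) =
      (\<integral>\<^sup>+ y. ennreal (\<phi> y) * (\<integral>\<^sup>+ z. indicator E z * u z \<partial>\<mu>) \<partial>\<mu>)"
    by (simp add: nn_integral_multc meas mass)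
  also have "\<dots> \<le> (\<integral>\<^sup>+ y. ennreal (\<phi> y) *
      (\<integral>\<^sup>+ z. indicator E (y * z) * (ennreal (n z) * u z) \<partial>\<mu>) \<partial>\<mu>)"
  proof (rule nn_integral_mono)
    fix y
    show "ennreal (\<phi> y) * (\<integral>\<^sup>+ z. indicator E z * u z \<partial>\<mu>) \<le> ennreal (\<phi> y) *
        (\<integral>\<^sup>+ z. indicator E (y * z) * (ennreal (n z) * u z) \<partial>\<mu>)"
    proof (cases "\<phi> y = 0")
      case False
      then show ?thesis
        by (intro mult_left_mono nn_integral_mono) (auto simp: E indicator_def)
    qed simp
  qed
  also have "\<dots> = (\<integral>\<^sup>+ x. indicator E x *
      (\<integral>\<^sup>+ y. ennreal (\<phi> y) * (ennreal (n (inverse y * x)) * u (inverse y * x)) \<partial>\<mu>) \<partial>\<mu>)"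
    by (rule haar_convolution_swap[OF haar, symmetric]) measurable
  also have "\<dots> = (\<integral>\<^sup>+ x. indicator E x * P u x \<partial>\<mu>)"
    unfolding P_def by (simp add: ennreal_mult' \<phi>_nonneg mult.assoc)
  finally show ?thesis .
qed

text \<open>Integrating \<open>G = 1\<^sub>D + P G\<close> over \<open>E\<close> gives \<open>\<integral>\<^sub>E G \<ge> \<mu> D + \<integral>\<^sub>E G\<close>.\<close>

lemma solution_not_L1:
  assumes [measurable]: "E \<in> sets borel" "D \<in> sets borel"
    and D: "D \<subseteq> E" "emeasure \<mu> D > 0" "emeasure \<mu> D < \<infinity>"
    and mass: "(\<integral>\<^sup>+ y. ennreal (\<phi> y) \<partial>\<mu>) = 1"
    and E: "\<And>y z. \<phi> y \<noteq> 0 \<Longrightarrow> z \<in> E \<Longrightarrow> y * z \<in> E" "\<And>z. z \<in> E \<Longrightarrow> n z = 1"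
    and u: "solves u (\<lambda>x. complex_of_real (indicator D x))"
  shows "(\<integral>\<^sup>+ x. ennreal (norm (u x)) \<partial>\<mu>) = \<infinity>"
proof -
  have "L2_sq \<mu> (\<lambda>x. complex_of_real (indicator D x)) = (\<integral>\<^sup>+ x. indicator D x \<partial>\<mu>)"
    unfolding L2_sq_def by (intro nn_integral_cong) (auto simp: indicator_def)
  then have D_L2: "(\<lambda>x. complex_of_real (indicator D x)) \<in> L2 \<mu>"
    using D by (simp add: L2_iff meas haar_sets[OF haar])
  obtain G where [measurable]: "G \<in> borel_measurable borel"
    and G: "\<And>x. G x = ennreal (indicator D x) + P G x"
    and sol: "solves (\<lambda>x. complex_of_real (enn2real (G x))) (\<lambda>x. complex_of_real (indicator D x))"
    and fin: "AE x in \<mu>. G x < \<infinity>"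
    by (rule solves_nonneg[OF _ _ D_L2]) auto
  let ?I = "\<integral>\<^sup>+ x. indicator E x * G x \<partial>\<mu>"
  have "emeasure \<mu> D + ?I \<le> emeasure \<mu> D + (\<integral>\<^sup>+ x. indicator E x * P G x \<partial>\<mu>)"
    by (intro add_left_mono L1_growth mass E) auto
  also have "\<dots> = (\<integral>\<^sup>+ x. indicator D x + indicator E x * P G x \<partial>\<mu>)"
    by (subst nn_integral_add) (auto simp: meas haar_sets[OF haar])
  also have "\<dots> = ?I"
    by (rule nn_integral_cong, subst G) (use D(1) in \<open>auto simp: indicator_def\<close>)
  finally have "?I = \<infinity>"
    using D(2) by (cases "?I"; cases "emeasure \<mu> D") (auto simp: top_unique simp flip: ennreal_plus)
  moreover have "?I \<le> (\<integral>\<^sup>+ x. ennreal (norm (u x)) \<partial>\<mu>)"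
  proof (rule nn_integral_mono_AE)
    show "AE x in \<mu>. indicator E x * G x \<le> ennreal (norm (u x))"
      using solves_unique[OF u sol] fin by eventually_elim (auto simp: indicator_def)
  qed
  ultimately show ?thesis by (simp add: top_unique)
qed

end

section \<open>Regular convolution dominated operators preserve $L^1$\<close>

text \<open>Where the integral does not converge, \<^const>\<open>twisted_rep\<close> has the value zero and the estimate is
  trivial.\<close>

lemma twisted_rep_bound:
  "ennreal (norm (twisted_rep \<mu> f h x)) \<le>
     (\<integral>\<^sup>+ y. ennreal (norm (f y)) * ennreal (norm (h (inverse y * x))) \<partial>\<mu>)"
proof (cases "integrable \<mu> (\<lambda>y. apply_bcontfun (f y) (inverse y * x) * h (inverse y * x))")
  case True
  have "ennreal (norm (twisted_rep \<mu> f h x)) \<le>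
      (\<integral>\<^sup>+ y. norm (apply_bcontfun (f y) (inverse y * x) * h (inverse y * x)) \<partial>\<mu>)"
    unfolding twisted_rep_def by (rule integral_norm_bound_ennreal[OF True])
  also have "\<dots> \<le> (\<integral>\<^sup>+ y. ennreal (norm (f y)) * ennreal (norm (h (inverse y * x))) \<partial>\<mu>)"
    by (intro nn_integral_mono)
      (simp add: norm_mult ennreal_mult[symmetric] norm_bounded mult_right_mono)
  finally show ?thesis .
qed (simp add: twisted_rep_def not_integrable_integral_eq)

lemma twisted_L1_norm_measurable:
  assumes "f \<in> twisted_L1 \<mu>"
  shows "(\<lambda>y. ennreal (norm (f y))) \<in> borel_measurable \<mu>"
proof -
  obtain s where s: "\<And>i::nat. simple_function \<mu> (s i)" "\<And>x. (\<lambda>i. s i x) \<longlonglongrightarrow> f x"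
    using assms by (auto simp: twisted_L1_def)
  have "(\<lambda>y. norm (f y)) \<in> borel_measurable \<mu>"
  proof (rule borel_measurable_LIMSEQ_real)
    show "(\<lambda>i. norm (s i y)) \<longlonglongrightarrow> norm (f y)" for y
      using s(2) by (rule tendsto_norm)
    show "(\<lambda>y. norm (s i y)) \<in> borel_measurable \<mu>" for i
      by (intro borel_measurable_simple_function simple_function_compose1[OF s(1)])
  qed
  then show ?thesis by measurable
qed

text \<open>The bound of \<open>twisted_rep_bound\<close> is a convolution of two integrable functions.\<close>

lemma adjoin_id_CD_reg_L1:
  fixes \<mu> :: "'a::{locally_compact_group, second_countable_topology} measure"
  assumes haar: "left_haar_measure \<mu>"
    and V: "V \<in> adjoin_id \<mu> (CD_reg \<mu>)"
    and h: "h \<in> L2 \<mu>" "(\<integral>\<^sup>+ x. ennreal (norm (h x)) \<partial>\<mu>) < \<infinity>"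
  shows "(\<integral>\<^sup>+ x. ennreal (norm (V h x)) \<partial>\<mu>) < \<infinity>"
proof -
  interpret sigma_finite_measure \<mu> by (rule haar_sigma_finite[OF haar])
  note meas = haar_measurable[OF haar] haar_pair_borel_measurable[OF haar]
  obtain A c where A: "A \<in> CD_reg \<mu>" "op_eq \<mu> V (\<lambda>h x. A h x + c * h x)"
    using V by (auto simp: adjoin_id_def)
  then obtain f where f: "f \<in> twisted_L1 \<mu>" "op_eq \<mu> A (twisted_rep \<mu> f)"
    by (auto simp: CD_reg_def)
  define \<phi> where "\<phi> y = ennreal (norm (f y))" for y
  define u where "u z = ennreal (norm (h z))" for z
  have [measurable]: "\<phi> \<in> borel_measurable borel"
    using twisted_L1_norm_measurable[OF f(1)] unfolding \<phi>_def meas .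
  have [measurable]: "u \<in> borel_measurable borel"
  proof -
    have [measurable]: "h \<in> borel_measurable borel" using h(1) by (simp add: L2_iff meas)
    show ?thesis unfolding u_def by measurable
  qed
  have "AE x in \<mu>. V h x = twisted_rep \<mu> f h x + c * h x"
  proof -
    have "AE x in \<mu>. V h x = A h x + c * h x" "AE x in \<mu>. A h x = twisted_rep \<mu> f h x"
      using A(2) f(2) h(1) by (auto simp: op_eq_def)
    then show ?thesis by eventually_elim simp
  qed
  then have "AE x in \<mu>. ennreal (norm (V h x)) \<le>
      (\<integral>\<^sup>+ y. \<phi> y * u (inverse y * x) \<partial>\<mu>) + ennreal (norm c) * u x"
  proof eventually_elim
    case (elim x)
    have "ennreal (norm (V h x)) \<le> ennreal (norm (twisted_rep \<mu> f h x)) + ennreal (norm c) * u x"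
      unfolding elim u_def
      by (simp add: ennreal_mult'[symmetric] ennreal_plus[symmetric] norm_mult[symmetric]
          norm_triangle_ineq ennreal_leI del: ennreal_plus)
    then show ?case
      using twisted_rep_bound[of \<mu> f h x] unfolding \<phi>_def u_def
      by (auto elim!: order_trans intro!: add_right_mono)
  qed
  then have "(\<integral>\<^sup>+ x. ennreal (norm (V h x)) \<partial>\<mu>) \<le>
      (\<integral>\<^sup>+ x. (\<integral>\<^sup>+ y. \<phi> y * u (inverse y * x) \<partial>\<mu>) + ennreal (norm c) * u x \<partial>\<mu>)"
    by (rule nn_integral_mono_AE)
  also have "\<dots> = (\<integral>\<^sup>+ x. (\<integral>\<^sup>+ y. \<phi> y * u (inverse y * x) \<partial>\<mu>) \<partial>\<mu>) +
      (\<integral>\<^sup>+ x. ennreal (norm c) * u x \<partial>\<mu>)"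
  proof (rule nn_integral_add)
    show "(\<lambda>x. \<integral>\<^sup>+ y. \<phi> y * u (inverse y * x) \<partial>\<mu>) \<in> borel_measurable \<mu>"
      unfolding meas by (rule borel_measurable_nn_integral, unfold meas) measurable
  qed (simp add: meas)
  also have "\<dots> = (\<integral>\<^sup>+ y. \<phi> y \<partial>\<mu>) * (\<integral>\<^sup>+ z. u z \<partial>\<mu>) + ennreal (norm c) * (\<integral>\<^sup>+ z. u z \<partial>\<mu>)"
    by (simp add: haar_convolution_L1[OF haar] nn_integral_cmult meas)
  also have "\<dots> < \<infinity>"
    using f(1) h(2) by (auto simp: twisted_L1_def \<phi>_def u_def ennreal_mult_less_top)
  finally show ?thesis .
qed

section \<open>A right uniformly continuous function on the affine group\<close>

definition tent :: "real \<Rightarrow> real" where "tent t = max 0 (min 1 (4 - \<bar>t\<bar>))"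

text \<open>A Lipschitz estimate in the affine parameters that is uniform in \<open>t\<close>.  The two arguments of \<^const>\<open>tent\<close>
  drift apart linearly in \<open>t\<close>, but only points at which one of them lies in the support \<open>[-4, 4]\<close>
  matter, and there the other one is close.\<close>

lemma tent_translate:
  assumes "a > 0" "c > 0"
  shows "\<bar>tent ((t - b) / a) - tent ((t - d) / c)\<bar> \<le>
    (4 * \<bar>a - c\<bar> + \<bar>b - d\<bar>) * (1 / a + 1 / c)"
proof -
  have key: "\<bar>tent ((t - b) / a) - tent ((t - d) / c)\<bar> \<le>
      (4 * \<bar>a - c\<bar> + \<bar>b - d\<bar>) * (1 / a + 1 / c)"
    if "a > 0" "c > 0" and w: "\<bar>(t - d) / c\<bar> \<le> 4" for a b c d
  proof -
    define w where "w = (t - d) / c"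
    have "t = c * w + d" using that by (simp add: w_def)
    then have "(t - b) / a - w = ((c - a) * w + (d - b)) / a"
      using that by (simp add: field_simps)
    then have "\<bar>(t - b) / a - w\<bar> = \<bar>(c - a) * w + (d - b)\<bar> / a"
      using that by simp
    also have "\<dots> \<le> (4 * \<bar>a - c\<bar> + \<bar>b - d\<bar>) / a"
    proof (intro divide_right_mono)
      have "\<bar>(c - a) * w\<bar> \<le> \<bar>a - c\<bar> * 4"
        unfolding abs_mult using w unfolding w_def[symmetric] by (intro mult_mono) auto
      then show "\<bar>(c - a) * w + (d - b)\<bar> \<le> 4 * \<bar>a - c\<bar> + \<bar>b - d\<bar>" by linarith
    qed (use that in simp)
    also have "\<dots> \<le> (4 * \<bar>a - c\<bar> + \<bar>b - d\<bar>) * (1 / a + 1 / c)"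
      using that by (simp add: distrib_left)
    finally have "\<bar>(t - b) / a - w\<bar> \<le> (4 * \<bar>a - c\<bar> + \<bar>b - d\<bar>) * (1 / a + 1 / c)" .
    moreover have "\<bar>tent x - tent y\<bar> \<le> \<bar>x - y\<bar>" for x y
      unfolding tent_def by linarith
    ultimately show ?thesis unfolding w_def by (meson order_trans)
  qed
  consider "\<bar>(t - d) / c\<bar> \<le> 4" | "\<bar>(t - b) / a\<bar> \<le> 4"
    | "\<bar>(t - d) / c\<bar> > 4" "\<bar>(t - b) / a\<bar> > 4"
    by linarith
  then show ?thesis
  proof cases
    case 1
    then show ?thesis by (rule key[OF assms])
  next
    case 2
    from key[OF assms(2,1) this, of d] show ?thesis
      by (simp add: abs_minus_commute add.commute)
  next
    case 3
    then have "tent ((t - d) / c) = 0" "tent ((t - b) / a) = 0" by (auto simp: tent_def)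
    then show ?thesis using assms by simp
  qed
qed

definition bump :: "aff \<Rightarrow>\<^sub>C complex" where
  "bump = Bcontfun (\<lambda>z. complex_of_real (tent (trn z)))"

lemma tent_bounds: "0 \<le> tent t" "tent t \<le> 1"
  by (auto simp: tent_def)

lemma continuous_on_tent_trn: "continuous_on UNIV (\<lambda>z. tent (trn z))"
  unfolding tent_def by (intro continuous_intros continuous_on_coords)

lemma apply_bump [simp]: "apply_bcontfun bump z = complex_of_real (tent (trn z))"
proof -
  have "bounded (range (\<lambda>z. complex_of_real (tent (trn z))))"
    using tent_bounds by (intro boundedI[of _ 1]) auto
  moreover have "continuous_on UNIV (\<lambda>z. complex_of_real (tent (trn z)))"
    by (intro continuous_intros continuous_on_tent_trn)
  ultimately show ?thesis
    by (simp add: bump_def Bcontfun_inverse bcontfun_def)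
qed

lemma bump_Ruc: "bump \<in> Ruc"
proof -
  have "((\<lambda>y. left_translate y bump) \<longlongrightarrow> left_translate x bump) (nhds x)" for x
  proof -
    define b where "b y = (4 * \<bar>dil y - dil x\<bar> + \<bar>trn y - trn x\<bar>) * (1 / dil y + 1 / dil x)" for y
    have "dil y \<noteq> 0" for y
      using dil_pos[of y] by linarith
    then have "continuous_on UNIV b"
      unfolding b_def by (intro continuous_intros continuous_on_coords) auto
    then have "(b \<longlongrightarrow> b x) (nhds x)"
      by (simp add: continuous_on_UNIV_iff_nhds)
    then have b0: "(b \<longlongrightarrow> 0) (nhds x)"
      by (simp add: b_def)
    have "dist (left_translate y bump) (left_translate x bump) \<le> b y" for y
    proof (rule dist_bound)
      fix z
      have "trn (inverse y * z) = (trn z - trn y) / dil y" for y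
        by (simp add: diff_divide_distrib)
      then show "dist (apply_bcontfun (left_translate y bump) z)
          (apply_bcontfun (left_translate x bump) z) \<le> b y"
        unfolding b_def using tent_translate[OF dil_pos dil_pos]
        by (simp only: apply_left_translate apply_bump dist_of_real dist_real_def)
    qed
    then have "\<forall>\<^sub>F y in nhds x. norm (dist (left_translate y bump) (left_translate x bump)) \<le> b y"
      by (intro always_eventually) simp
    from Lim_null_comparison[OF this b0] show ?thesis
      by (rule tendsto_dist_iff[THEN iffD2])
  qed
  then show ?thesis by (simp add: Ruc_def continuous_on_UNIV_iff_nhds)
qed

lemma Ruc_scaleR: "m \<in> Ruc \<Longrightarrow> c *\<^sub>R m \<in> Ruc"
proof -
  assume "m \<in> Ruc"
  then have "continuous_on UNIV (\<lambda>y. c *\<^sub>R left_translate y m)"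
    by (auto simp: Ruc_def intro: continuous_intros)
  moreover have "c *\<^sub>R left_translate y m = left_translate y (c *\<^sub>R m)" for y
    by (rule bcontfun_eqI) simp
  ultimately show ?thesis by (simp add: Ruc_def)
qed

section \<open>Haar measure of strips in the affine group\<close>

text \<open>The factor \<open>1 / 16\<close> makes the image of the interval \<open>[-4, 4]\<close>, the support of \<^const>\<open>tent\<close>, shorter
  than one; the lower bound keeps the strips over bounded intervals relatively compact.\<close>

definition strip :: "real set \<Rightarrow> aff set" where
  "strip A = {y. dil y \<in> {1 / 32..1 / 16} \<and> trn y \<in> A}"

lemma strip_borel [measurable]: "A \<in> sets borel \<Longrightarrow> strip A \<in> sets borel"
proof -
  assume "A \<in> sets borel"
  then have "dil -` {1 / 32..1 / 16} \<inter> trn -` A \<in> sets borel"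
    by (intro sets.Int measurable_sets_borel[OF measurable_coords(1)]
        measurable_sets_borel[OF measurable_coords(2)]) auto
  also have "dil -` {1 / 32..1 / 16} \<inter> trn -` A = strip A"
    by (auto simp: strip_def)
  finally show ?thesis .
qed

lemma continuous_on_mk_aff: "continuous_on ({0<..} \<times> UNIV) (\<lambda>p. mk_aff (fst p) (snd p))"
proof -
  have "continuous_on ({0<..} \<times> UNIV) (\<lambda>p::real \<times> real. aff_matrix (fst p) (snd p))"
    by (intro continuous_on_aff_matrix continuous_intros)
  then show ?thesis
    unfolding continuous_on_aff_iff
    by (rule continuous_on_eq) (auto simp: Rep_aff_coords)
qed

lemma mk_aff_coords: "mk_aff (dil x) (trn x) = x"
  by (simp add: mk_aff_def Rep_aff_coords[symmetric] Rep_aff_inverse)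

context
  fixes \<mu> :: "aff measure"
  assumes haar: "left_haar_measure \<mu>"
begin

lemma strip_translate: "A \<in> sets borel \<Longrightarrow> emeasure \<mu> (strip ((\<lambda>s. t + s) ` A)) = emeasure \<mu> (strip A)"
proof -
  assume A: "A \<in> sets borel"
  have "strip ((\<lambda>s. t + s) ` A) = (\<lambda>y. mk_aff 1 t * y) ` strip A"
  proof (intro set_eqI iffI)
    fix z assume "z \<in> strip ((\<lambda>s. t + s) ` A)"
    then have "inverse (mk_aff 1 t) * z \<in> strip A" by (auto simp: strip_def)
    then have "mk_aff 1 t * (inverse (mk_aff 1 t) * z) \<in> (\<lambda>y. mk_aff 1 t * y) ` strip A"
      by (rule imageI)
    then show "z \<in> (\<lambda>y. mk_aff 1 t * y) ` strip A" by (simp only: inverse_mult_cancel_group)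
  qed (auto simp: strip_def)
  then show ?thesis
    using haar_translate[OF haar, of "strip A"] A by simp
qed

lemma strip_unit: "emeasure \<mu> (strip {t..<t + 1}) = emeasure \<mu> (strip {0..<1})"
  using strip_translate[of "{0..<1}" t] by (simp add: add.commute)

lemma strip_split:
  assumes "a \<le> b" "b \<le> c"
  shows "emeasure \<mu> (strip {a..<c}) = emeasure \<mu> (strip {a..<b}) + emeasure \<mu> (strip {b..<c})"
proof -
  have "strip {a..<c} = strip {a..<b} \<union> strip {b..<c}" "strip {a..<b} \<inter> strip {b..<c} = {}"
    using assms by (auto simp: strip_def)
  then show ?thesis
    by (simp add: plus_emeasure haar_sets[OF haar])
qed

lemma strip_4: "emeasure \<mu> (strip {-2..<2}) = 4 * emeasure \<mu> (strip {0..<1})"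
proof -
  have "emeasure \<mu> (strip {-2..<2}) = emeasure \<mu> (strip {-2..<-1}) + (emeasure \<mu> (strip {-1..<0}) +
      (emeasure \<mu> (strip {0..<1}) + emeasure \<mu> (strip {1..<2})))"
    by (simp add: strip_split[of "-2" "-1" 2] strip_split[of "-1" 0 2] strip_split[of 0 1 2])
  also have "\<dots> = 4 * emeasure \<mu> (strip {0..<1})"
    using strip_unit[of "-2"] strip_unit[of "-1"] strip_unit[of 1]
    by (simp add: distrib_right[symmetric] flip: mult_2 add.assoc)
  finally show ?thesis .
qed

lemma strip_finite: "emeasure \<mu> (strip {0..<1}) < \<infinity>"
proof -
  let ?K = "(\<lambda>p. mk_aff (fst p) (snd p)) ` ({1 / 32..1 / 16} \<times> {0..1})"
  have K: "compact ?K"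
    by (intro compact_continuous_image continuous_on_subset[OF continuous_on_mk_aff] compact_Times compact_Icc) auto
  have "strip {0..<1} \<subseteq> ?K"
  proof
    fix y assume "y \<in> strip {0..<1}"
    then show "y \<in> ?K"
      by (intro image_eqI[of _ _ "(dil y, trn y)"]) (auto simp: strip_def mk_aff_coords)
  qed
  then have "emeasure \<mu> (strip {0..<1}) \<le> emeasure \<mu> ?K"
    by (rule emeasure_mono) (simp add: haar_sets[OF haar] borel_compact K)
  then show ?thesis
    using haar_compact[OF haar K] by (rule le_less_trans)
qed

text \<open>The strip contains a nonempty open box.\<close>

lemma strip_pos: "emeasure \<mu> (strip {0..<1}) > 0"
proof -
  let ?U = "{y. 1 / 32 < dil y \<and> dil y < 1 / 16 \<and> 0 < trn y \<and> trn y < 1}"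
  have "open ?U"
    by (intro open_Collect_conj open_Collect_less continuous_on_coords continuous_intros)
  moreover have "mk_aff (3 / 64) (1 / 2) \<in> ?U" by simp
  then have "?U \<noteq> {}" by blast
  ultimately have "0 < emeasure \<mu> ?U"
    by (rule haar_open_pos[OF haar])
  also have "\<dots> \<le> emeasure \<mu> (strip {0..<1})"
    by (intro emeasure_mono) (auto simp: strip_def haar_sets[OF haar])
  finally show ?thesis .
qed

end

section \<open>Failure of inverse-closedness\<close>

theorem corollary5p2:
  fixes \<mu> :: "aff measure"
  assumes "left_haar_measure \<mu>"
  shows "\<not> inverse_closed \<mu> (CD_reg \<mu>)"
proof
  assume closed: "inverse_closed \<mu> (CD_reg \<mu>)"
  note haar = assms
  define w where "w = measure \<mu> (strip {0..<1})"
  have w: "emeasure \<mu> (strip {0..<1}) = ennreal w"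
    unfolding w_def using strip_finite[OF haar] by (intro emeasure_eq_ennreal_measure) auto
  have "w > 0" using strip_pos[OF haar] w by simp
  \<comment> \<open>The support of \<open>\<phi>\<close> is four unit strips, so that its total mass is one and every unit strip
    has mass at most \<open>1 / 4\<close>.\<close>
  define \<phi> where "\<phi> y = 1 / (4 * w) * indicator (strip {-2..<2}) y" for y
  define n where "n z = tent (trn z)" for z
  \<comment> \<open>The sign is chosen so that \<open>f\<close> represents \<open>- S\<close>, whose sum with the identity is \<open>id - S\<close>.\<close>
  define f where "f y = (- \<phi> y) *\<^sub>R bump" for y
  have \<phi>_integral: "(\<integral>\<^sup>+ y. ennreal (\<phi> y) \<partial>\<mu>) = 1"
  proof -
    have "(\<integral>\<^sup>+ y. ennreal (\<phi> y) \<partial>\<mu>) = (\<integral>\<^sup>+ y. ennreal (1 / (4 * w)) * indicator (strip {-2..<2}) y \<partial>\<mu>)"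
      by (intro nn_integral_cong) (auto simp: \<phi>_def indicator_def)
    also have "\<dots> = ennreal (1 / (4 * w)) * (4 * ennreal w)"
      by (subst nn_integral_cmult_indicator) (simp_all add: haar_sets[OF haar] strip_4[OF haar] w)
    also have "4 * ennreal w = ennreal (4 * w)"
      by (simp add: ennreal_mult')
    also have "ennreal (1 / (4 * w)) * ennreal (4 * w) = ennreal (1 / (4 * w) * (4 * w))"
      using \<open>w > 0\<close> by (intro ennreal_mult[symmetric]) auto
    finally show ?thesis using \<open>w > 0\<close> by simp
  qed
  interpret small_convolution \<mu> \<phi> n
  proof
    show "\<phi> \<in> borel_measurable borel" unfolding \<phi>_def by measurable
    show "n \<in> borel_measurable borel" unfolding n_def tent_def by measurable
    fix x
    \<comment> \<open>Only the \<open>y\<close> with \<open>\<bar>trn x - trn y\<bar> < 4 * dil y \<le> 1 / 4\<close> contribute; the half-open unit strip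
      around \<open>trn x\<close> contains them and has known measure.\<close>
    let ?D = "strip {trn x - 1 / 2..<(trn x - 1 / 2) + 1}"
    have "(\<integral>\<^sup>+ y. ennreal (\<phi> y * n (inverse y * x)) \<partial>\<mu>) \<le>
        (\<integral>\<^sup>+ y. ennreal (1 / (4 * w)) * indicator ?D y \<partial>\<mu>)"
    proof (rule nn_integral_mono)
      fix y
      show "ennreal (\<phi> y * n (inverse y * x)) \<le> ennreal (1 / (4 * w)) * indicator ?D y"
      proof (cases "\<phi> y * n (inverse y * x) = 0")
        case False
        then have y: "y \<in> strip {-2..<2}" and "n (inverse y * x) \<noteq> 0"
          by (auto simp: \<phi>_def indicator_def split: if_splits)
        then have "\<bar>trn (inverse y * x)\<bar> < 4"
          by (auto simp: n_def tent_def max_def min_def split: if_splits)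
        moreover have "trn (inverse y * x) = (trn x - trn y) / dil y"
          by (simp add: diff_divide_distrib)
        ultimately have "\<bar>trn x - trn y\<bar> < 4 * dil y"
          by (simp add: abs_of_pos[OF dil_pos] pos_divide_less_eq)
        moreover have "dil y \<in> {1 / 32..1 / 16}" using y by (simp add: strip_def)
        ultimately have "trn y \<in> {trn x - 1 / 2..<(trn x - 1 / 2) + 1}"
          unfolding atLeastLessThan_iff atLeastAtMost_iff by linarith
        with y have "y \<in> ?D" by (simp add: strip_def)
        moreover have "\<phi> y * n (inverse y * x) \<le> 1 / (4 * w) * 1"
          using \<open>w > 0\<close> tent_bounds by (intro mult_mono) (auto simp: \<phi>_def n_def indicator_def)
        ultimately show ?thesis by (simp add: ennreal_leI)
      next
        case True
        show ?thesis unfolding True by simp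
      qed
    qed
    also have "\<dots> = ennreal (1 / (4 * w)) * ennreal w"
      using strip_unit[OF haar, of "trn x - 1 / 2"]
      by (subst nn_integral_cmult_indicator) (simp_all add: haar_sets[OF haar] w)
    also have "\<dots> = ennreal (1 / (4 * w) * w)"
      using \<open>w > 0\<close> by (intro ennreal_mult[symmetric]) auto
    also have "1 / (4 * w) * w = 1 / 4"
      using \<open>w > 0\<close> by simp
    also have "ennreal (1 / 4) = 1 / 4"
      using divide_ennreal[of 1 4] by simp
    finally show "(\<integral>\<^sup>+ y. ennreal (\<phi> y * n (inverse y * x)) \<partial>\<mu>) \<le> 1 / 4" .
  qed (use haar \<open>w > 0\<close> \<phi>_integral tent_bounds in \<open>auto simp: \<phi>_def n_def\<close>)
  have f_rep: "twisted_rep \<mu> f h x = - S h x" for h x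
    unfolding twisted_rep_def S_def f_def n_def
    by (simp add: scaleR_conv_of_real)
  have f_L1: "f \<in> twisted_L1 \<mu>"
  proof -
    have f_Ruc: "f x \<in> Ruc" for x
      unfolding f_def by (intro Ruc_scaleR bump_Ruc)
    have "simple_function \<mu> \<phi>"
      unfolding \<phi>_def by (intro simple_function_mult simple_function_const simple_function_indicator)
        (simp add: haar_sets[OF haar])
    then have "simple_function \<mu> f"
      unfolding f_def by (rule simple_function_compose1)
    moreover have "(\<integral>\<^sup>+ x. ennreal (norm (f x)) \<partial>\<mu>) = (\<integral>\<^sup>+ x. ennreal (\<phi> x) * ennreal (norm bump) \<partial>\<mu>)"
      unfolding f_def using \<phi>_nonneg by (intro nn_integral_cong) (simp add: ennreal_mult)
    then have "(\<integral>\<^sup>+ x. ennreal (norm (f x)) \<partial>\<mu>) < \<infinity>"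
      by (simp add: nn_integral_multc meas \<phi>_integral)
    ultimately show ?thesis
      unfolding twisted_L1_def using f_Ruc by (auto intro!: exI[of _ "\<lambda>_. f"])
  qed
  define T where "T h x = h x - S h x" for h x
  have "twisted_rep \<mu> f \<in> CD_reg \<mu>"
  proof -
    have "twisted_rep \<mu> f = (\<lambda>h x. - S h x)" by (intro ext f_rep)
    then have "twisted_rep \<mu> f \<in> B_L2 \<mu>" by (simp add: minus_S_in_B_L2)
    with f_L1 show ?thesis by (auto simp: CD_reg_def op_eq_def)
  qed
  moreover have "op_eq \<mu> T (\<lambda>h x. twisted_rep \<mu> f h x + 1 * h x)"
    by (simp add: op_eq_def T_def f_rep)
  moreover have "T \<in> B_L2 \<mu>"
    using id_minus_S_in_B_L2 unfolding T_def[abs_def] .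
  ultimately have "T \<in> adjoin_id \<mu> (CD_reg \<mu>)"
    unfolding adjoin_id_def by blast
  moreover have "invertible_in \<mu> (B_L2 \<mu>) T"
    using id_minus_S_invertible unfolding T_def[abs_def] .
  ultimately obtain V where V: "V \<in> adjoin_id \<mu> (CD_reg \<mu>)" "op_eq \<mu> (T \<circ> V) id"
    using closed by (auto simp: inverse_closed_def invertible_in_def)
  \<comment> \<open>A point of the support of \<open>\<phi>\<close> maps this band into itself since \<open>3 / 16 + 2 \<le> 3\<close>.\<close>
  define E where "E = {z. \<bar>trn z\<bar> \<le> 3}"
  define D where "D = strip {0..<1}"
  define h where "h x = complex_of_real (indicator D x)" for x
  have [measurable]: "D \<in> sets borel" by (simp add: D_def)
  have h_sq: "(ennreal (norm (h x)))\<^sup>2 = indicator D x"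
    and h_norm: "ennreal (norm (h x)) = indicator D x" for x
    by (auto simp: h_def indicator_def)
  have h: "h \<in> L2 \<mu>"
    unfolding L2_iff L2_sq_def h_sq
  proof
    show "h \<in> borel_measurable \<mu>" by (simp add: meas h_def[abs_def])
    show "(\<integral>\<^sup>+ x. indicator D x \<partial>\<mu>) < \<infinity>"
      using w by (simp add: haar_sets[OF haar] D_def)
  qed
  have "solves (V h) h"
    using V h by (auto simp: solves_def op_eq_def adjoin_id_def B_L2_def T_def)
  have "(\<integral>\<^sup>+ x. ennreal (norm (V h x)) \<partial>\<mu>) = \<infinity>"
  proof (rule solution_not_L1)
    show "E \<in> sets borel" unfolding E_def by measurable
    show "D \<subseteq> E" by (auto simp: D_def E_def strip_def)
    show "emeasure \<mu> D > 0" "emeasure \<mu> D < \<infinity>" using w \<open>w > 0\<close> by (simp_all add: D_def)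
    show "solves (V h) (\<lambda>x. complex_of_real (indicator D x))"
      using \<open>solves (V h) h\<close> unfolding h_def .
    fix y z assume "z \<in> E"
    then show "n z = 1" by (simp add: E_def n_def tent_def)
    assume "\<phi> y \<noteq> 0"
    then have y: "dil y \<le> 1 / 16" "\<bar>trn y\<bar> \<le> 2"
      by (auto simp: \<phi>_def strip_def indicator_def split: if_splits)
    have "\<bar>dil y * trn z\<bar> \<le> 1 / 16 * 3"
      unfolding abs_mult using y \<open>z \<in> E\<close> by (intro mult_mono) (auto simp: E_def less_imp_le)
    with y show "y * z \<in> E" by (simp add: E_def)
  qed (simp_all add: \<phi>_integral)
  moreover have "(\<integral>\<^sup>+ x. ennreal (norm (V h x)) \<partial>\<mu>) < \<infinity>"
    using w by (intro adjoin_id_CD_reg_L1[OF haar V(1) h]) (simp add: h_norm haar_sets[OF haar] D_def)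
  ultimately show False by simp
qed

end
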